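(* Let $M \ge 2$ be an integer, let $\mathcal A \subset \{0, \dots, M-1\}$ be nonempty, and let $\chi \in \mathcal G^s_{c}((0,1))$ for some $s > 1$, with values in $[0,1]$. Let $B_N$ be the associated quantum open baker's map, $\mathcal N_N(\nu)$ its eigenvalue counting function, and $\delta = \frac{\log|\mathcal A|}{\log M}$. Then there is a constant $C$ depending only on $\chi$ and $M$ such that for all $\nu \ge 1$ and all sufficiently large $N = KM$ with $K \in \mathbb N$, $$\mathcal N_N(\nu) \le C N^\delta \nu^{(1-\delta)s}.$$
   Context: For $N \in \mathbb N$, $\mathbb Z_N = \mathbb Z/N\mathbb Z \simeq \{0,\dots,N-1\}$ and $\ell^2_N = \ell^2(\mathbb Z_N)$. The unitary discrete Fourier transform is $\mathcal F_N u(j) = N^{-1/2}\sum_{\ell=0}^{N-1} e^{-2\pi i j\ell/N} u(\ell)$. Let $N = KM$ with $K \in \mathbb N$. For $a \in \{0,\dots,M-1\}$ define $\Pi_a : \ell^2_N \to \ell^2_K$ by $\Pi_a u(j) = u(j + aK)$, $j \in \{0,\dots,K-1\}$. The quantum open baker's map is $$B_N = \sum_{a \in \mathcal A} \mathcal F_N^* \Pi_a^* \chi_K \mathcal F_K \chi_K \Pi_a,$$ where $\chi_K$ is multiplication by $j \mapsto \chi(j/K)$ on $\ell^2_K$. For $\nu \ge 0$, $\mathcal N_N(\nu)$ is the number of eigenvalues $\lambda$ of $B_N$ with $|\lambda| \ge M^{-\nu}$, counted with multiplicity. For $s>1$, $\mathcal G^s_c((0,1))$ is the set of $f \in C_c^\infty(\mathbb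 R)$ with $\operatorname{supp} f \subset (0,1)$ that are $s$-Gevrey: for every compact $K' \subset \mathbb R$ there is $C_{K',f}$ with $\sup_{x \in K'}|\partial^\alpha f(x)| \le C_{K',f}^{\alpha+1}(\alpha!)^s$ for all integers $\alpha \ge 0$. *)

theory Defs
  imports "HOL-Analysis.Analysis" "Jordan_Normal_Form.Char_Poly" "Jordan_Normal_Form.Schur_Decomposition"
begin

definition smooth_fun :: "(real \<Rightarrow> real) \<Rightarrow> bool" where
  "smooth_fun f \<longleftrightarrow> (\<forall>k x. ((deriv ^^ k) f) differentiable (at x))"

definition gevrey_c01 :: "real \<Rightarrow> (real \<Rightarrow> real) \<Rightarrow> bool" where
  "gevrey_c01 s f \<longleftrightarrow> smooth_fun f
     \<and> closure {x. f x \<noteq> 0} \<subseteq> {0<..<1}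
     \<and> compact (closure {x. f x \<noteq> 0})
     \<and> (\<forall>K'. compact K' \<longrightarrow> (\<exists>C. \<forall>\<alpha>::nat. \<forall>x\<in>K'.
           \<bar>(deriv ^^ \<alpha>) f x\<bar> \<le> C ^ (\<alpha> + 1) * (fact \<alpha>) powr s))"

definition dft_mat :: "nat \<Rightarrow> complex mat" where
  "dft_mat N = mat N N (\<lambda>(j, l). exp (- 2 * pi * \<i> * of_nat j * of_nat l / of_nat N)
                                   / complex_of_real (sqrt (real N)))"

definition Pi_mat :: "nat \<Rightarrow> nat \<Rightarrow> nat \<Rightarrow> complex mat" where
  "Pi_mat K N a = mat K N (\<lambda>(j, n). if n = j + a * K then 1 else 0)"

definition chi_mat :: "(real \<Rightarrow> real) \<Rightarrow> nat \<Rightarrow> complex mat" where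
  "chi_mat ch K = mat K K (\<lambda>(i, j). if i = j then complex_of_real (ch (real i / real K)) else 0)"

definition baker_mat :: "nat \<Rightarrow> nat set \<Rightarrow> (real \<Rightarrow> real) \<Rightarrow> nat \<Rightarrow> complex mat" where
  "baker_mat M \<A> ch K = (let N = K * M in
     mat N N (\<lambda>ij. \<Sum>a\<in>\<A>.
       (mat_adjoint (dft_mat N) * mat_adjoint (Pi_mat K N a) * chi_mat ch K * dft_mat K
          * chi_mat ch K * Pi_mat K N a) $$ ij))"

definition eig_count :: "nat \<Rightarrow> nat set \<Rightarrow> (real \<Rightarrow> real) \<Rightarrow> nat \<Rightarrow> real \<Rightarrow> nat" where
  "eig_count M \<A> ch K \<nu> = (let p = char_poly (baker_mat M \<A> ch K) in
     \<Sum>z\<in>{z. poly p z = 0 \<and> cmod z \<ge> real M powr (- \<nu>)}. Polynomial.order z p)"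

end

theory Submission
  imports Defs
begin

text \<open>
  On grid points \<open>x = i/N\<close>, \<open>y = n/N\<close> with \<open>n = j + aK\<close>, iterated summation by parts and the Gevrey
  bounds show that the entry \<open>(i, n)\<close> of the baker's map decays like \<open>exp (- (c |i - Mj|) powr (1/s))\<close>:
  up to this error the map sends \<open>y\<close> to \<open>M y - a\<close>. Let \<open>Y\<^sub>j\<close> be a neighbourhood of size about
  \<open>M\<^sup>-\<^sup>j\<close> of the level \<open>j\<close> Cantor set of the alphabet, and give each grid point the level
  \<open>j \<le> k\<close> at which it leaves these sets. The map lowers the level, up to errors controlled by the gaps
  between consecutive neighbourhoods. Choose \<open>k\<close> with \<open>N / M\<^sup>k\<close> comparable to a large multiple of
  \<open>\<nu> powr s\<close>. After conjugation by the weight \<open>T ^ level\<close> with \<open>T = M powr (P \<nu>)\<close>, the Schur test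
  makes the matrix bounded, and of norm \<open>O(1/T)\<close> on vectors vanishing on \<open>Y\<^sub>k\<close>. Working with the
  one-step weighted matrix, instead of the \<open>k\<close>-th power of the map, is what avoids a loss of \<open>log N\<close>.

  If \<open>n\<close> eigenvalues are at least \<open>M powr -\<nu>\<close> in modulus and \<open>Y\<^sub>k\<close> has \<open>r\<close> grid points, then
  Hadamard's inequality on the invariant subspace of these eigenvalues bounds their product by
  \<open>O(1) ^ r * O(1/T) ^ (n - r)\<close>, so \<open>n = O(r)\<close>; and \<open>r\<close> is at most a constant times
  \<open>|A| ^ k * N / M ^ k\<close>, which is of order \<open>N powr \<delta> * \<nu> powr ((1 - \<delta>) s)\<close>.
\<close>

section \<open>Unitary triangularisation and the Hadamard inequality\<close>

lemma of_real_cmod_power2: "(complex_of_real (cmod z))\<^sup>2 = z * cnj z"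
  by (metis complex_norm_square of_real_power)

lemma mat_adjoint_carrier: "A \<in> carrier_mat m n \<Longrightarrow> mat_adjoint A \<in> carrier_mat n m"
  by (auto simp: mat_adjoint_def)

lemma mat_adjoint_dim [simp]: "dim_row (mat_adjoint A) = dim_col A" "dim_col (mat_adjoint A) = dim_row A"
  by (auto simp: mat_adjoint_def)

lemma mat_adjoint_index [simp]:
  "i < dim_col A \<Longrightarrow> j < dim_row A \<Longrightarrow> mat_adjoint A $$ (i, j) = conjugate (A $$ (j, i))"
  by (simp add: mat_adjoint_def mat_of_rows_index)

lemma mat_adjoint_mult:
  fixes A B :: "complex mat"
  assumes A: "A \<in> carrier_mat m n" and B: "B \<in> carrier_mat n p"
  shows "mat_adjoint (A * B) = mat_adjoint B * mat_adjoint A"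
proof (rule eq_matI)
  show "dim_row (mat_adjoint (A * B)) = dim_row (mat_adjoint B * mat_adjoint A)"
    "dim_col (mat_adjoint (A * B)) = dim_col (mat_adjoint B * mat_adjoint A)"
    using A B by (auto simp: mat_adjoint_def)
  fix i j
  assume "i < dim_row (mat_adjoint B * mat_adjoint A)" "j < dim_col (mat_adjoint B * mat_adjoint A)"
  then have i: "i < p" and j: "j < m" using A B by (auto simp: mat_adjoint_def)
  show "mat_adjoint (A * B) $$ (i, j) = (mat_adjoint B * mat_adjoint A) $$ (i, j)"
    using A B i j by (auto simp: scalar_prod_def mult.commute intro!: sum.cong)
qed

lemma mat_adjoint_four_block:
  fixes P :: "complex mat"
  assumes P: "P \<in> carrier_mat n n"
  shows "mat_adjoint (four_block_mat (1\<^sub>m 1) (0\<^sub>m 1 n) (0\<^sub>m n 1) P)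
    = four_block_mat (1\<^sub>m 1) (0\<^sub>m 1 n) (0\<^sub>m n 1) (mat_adjoint P)"
  using P mat_adjoint_carrier[OF P]
  by (intro eq_matI) (auto simp: mat_adjoint_index mat_adjoint_def[of "four_block_mat _ _ _ _"] mat_of_rows_index)

text \<open>Gram-Schmidt keeps the first vector of the completed basis, and normalising only
  rescales it. This supplies the deflation step of Schur's theorem.\<close>

lemma unitary_with_first_col:
  fixes v :: "complex vec"
  assumes v: "v \<in> carrier_vec n" and v0: "v \<noteq> 0\<^sub>v n"
  shows "\<exists>W c. W \<in> carrier_mat n n \<and> mat_adjoint W * W = 1\<^sub>m n \<and> col W 0 = c \<cdot>\<^sub>v v"
proof -
  interpret cof_vec_space n "TYPE(complex)" .
  define b where "b = basis_completion v"
  define ws where "ws = gram_schmidt n b"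
  have n: "n \<noteq> 0" using v v0 by auto
  note bc = basis_completion[OF v v0, folded b_def]
  obtain vs where bv: "b = v # vs" using bc n by (cases b) auto
  have ws: "set ws \<subseteq> carrier_vec n" "corthogonal ws" "length ws = n"
    using gram_schmidt_result[OF bc(2,4,5) refl, folded ws_def] bc(6) by auto
  have hd: "hd ws = v" using gram_schmidt_hd[OF v, of vs, folded bv] ws_def by simp
  have ws0: "ws ! 0 = v" using hd ws(3) n hd_conv_nth[of ws] by fastforce
  \<comment> \<open>\<open>gram_schmidt\<close> yields orthogonal vectors of arbitrary length;
    \<open>d\<close> rescales them to unit vectors.\<close>
  define d where "d j = complex_of_real (1 / sqrt (\<Sum>i<n. (cmod (ws ! j $ i))\<^sup>2))" for j
  define W where "W = mat n n (\<lambda>(i, j). d j * ws ! j $ i)"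
  have W: "W \<in> carrier_mat n n" by (simp add: W_def)
  have wsc: "ws ! j \<in> carrier_vec n" if "j < n" for j using ws that by auto
  have prod: "ws ! i \<bullet>c ws ! j = (\<Sum>k<n. ws ! i $ k * cnj (ws ! j $ k))" if "i < n" "j < n" for i j
    using wsc[OF that(1)] wsc[OF that(2)] by (simp add: scalar_prod_def lessThan_atLeast0)
  have "mat_adjoint W * W = 1\<^sub>m n"
  proof (rule eq_matI)
    fix i j assume "i < dim_row (1\<^sub>m n :: complex mat)" "j < dim_col (1\<^sub>m n :: complex mat)"
    then have i: "i < n" and j: "j < n" by auto
    have e: "(mat_adjoint W * W) $$ (i, j) = cnj (d i) * d j * (ws ! j \<bullet>c ws ! i)"
      using i j unfolding prod[OF j i]
      by (auto simp: scalar_prod_def W_def sum_distrib_left lessThan_atLeast0 intro!: sum.cong)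
    show "(mat_adjoint W * W) $$ (i, j) = 1\<^sub>m n $$ (i, j)"
    proof (cases "i = j")
      case False
      then have "ws ! j \<bullet>c ws ! i = 0" using corthogonalD[OF ws(2), of j i] ws(3) i j by auto
      then show ?thesis using False i j e by simp
    next
      case True
      define q where "q = (\<Sum>k<n. (cmod (ws ! j $ k))\<^sup>2)"
      have s: "ws ! j \<bullet>c ws ! j = complex_of_real q"
        unfolding prod[OF j j] q_def by (simp add: of_real_cmod_power2)
      have "ws ! j \<bullet>c ws ! j \<noteq> 0" using corthogonalD[OF ws(2), of j j] ws(3) j by auto
      then have "q \<noteq> 0" using s by auto
      moreover have "q \<ge> 0" unfolding q_def by (intro sum_nonneg) auto
      ultimately have q: "q > 0" by simp
      have "cnj (d j) * d j = complex_of_real (1 / q)"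
        unfolding d_def q_def[symmetric] using q by (simp flip: of_real_mult)
      then show ?thesis using e True i j s q by (simp flip: of_real_mult)
    qed
  qed (use W mat_adjoint_carrier[OF W] in auto)
  moreover have "col W 0 = d 0 \<cdot>\<^sub>v v"
    using n v ws0 by (intro eq_vecI) (auto simp: W_def)
  ultimately show ?thesis using W by blast
qed

text \<open>Deflation: a unitary whose first column is an eigenvector for \<open>e\<close> splits
  off a 1 by 1 block, and the remaining block carries the eigenvalues \<open>es\<close>. The order
  of \<open>es\<close> is free, which later allows the large eigenvalues to come first.\<close>

lemma unitary_schur:
  fixes A :: "complex mat"
  assumes "A \<in> carrier_mat n n" and "char_poly A = (\<Prod>e\<leftarrow>es. [:- e, 1:])"
  shows "\<exists>T U. similar_mat_wit A T U (mat_adjoint U) \<and> upper_triangular T \<and> diag_mat T = es"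
  using assms
proof (induction es arbitrary: n A)
  case Nil
  then have "n = 0" using degree_monic_char_poly[of A n] by auto
  then have "mat_adjoint (1\<^sub>m n :: complex mat) = 1\<^sub>m n" by (intro eq_matI) (auto simp: mat_adjoint_def)
  then have "similar_mat_wit A A (1\<^sub>m n) (mat_adjoint (1\<^sub>m n))"
    using similar_mat_wit_refl[OF Nil(1)] by simp
  then show ?case using Nil \<open>n = 0\<close> by (intro exI[of _ A] exI[of _ "1\<^sub>m n"]) (auto simp: diag_mat_def)
next
  case (Cons e es)
  note A = Cons.prems(1)
  have cp: "char_poly A = [: -e, 1 :] * (\<Prod>e \<leftarrow> es. [:- e, 1:])" using Cons.prems(2) by simp
  have ev: "eigenvalue A e" unfolding eigenvalue_root_char_poly[OF A] cp by simp
  then obtain v where v: "v \<in> carrier_vec n" "v \<noteq> 0\<^sub>v n" and Av: "A *\<^sub>v v = e \<cdot>\<^sub>v v"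
    using A unfolding eigenvalue_def eigenvector_def by auto
  have n: "n \<noteq> 0" using v by auto
  define m where "m = n - 1"
  have nm: "n = 1 + m" using n by (simp add: m_def)
  obtain W c where W: "W \<in> carrier_mat n n" and WW: "mat_adjoint W * W = 1\<^sub>m n"
    and colW: "col W 0 = c \<cdot>\<^sub>v v" using unitary_with_first_col[OF v] by blast
  note W' = mat_adjoint_carrier[OF W]
  have WW2: "W * mat_adjoint W = 1\<^sub>m n" using mat_mult_left_right_inverse[OF W' W WW] .
  define A' where "A' = mat_adjoint W * A * W"
  have A': "A' \<in> carrier_mat n n" using W W' A by (simp add: A'_def)
  have wit: "similar_mat_wit A' A (mat_adjoint W) W"
    by (rule similar_mat_witI[of _ _ n]) (use W W' A A' WW WW2 in \<open>auto simp: A'_def\<close>)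
  have sim: "similar_mat_wit A A' W (mat_adjoint W)" using similar_mat_wit_sym[OF wit] .
  have "col A' 0 = mat_adjoint W *\<^sub>v (A *\<^sub>v col W 0)"
  proof -
    have "A' = mat_adjoint W * (A * W)" using A W W' by (simp add: A'_def)
    also have "col \<dots> 0 = mat_adjoint W *\<^sub>v col (A * W) 0"
      using A W W' n by (intro col_mult2[of _ n n _ n]) auto
    also have "col (A * W) 0 = A *\<^sub>v col W 0" using A W n by (intro col_mult2[of _ n n _ n]) auto
    finally show ?thesis .
  qed
  also have "A *\<^sub>v col W 0 = e \<cdot>\<^sub>v col W 0"
    unfolding colW using A v Av mult_mat_vec[of A n n v c] by (simp add: smult_smult_assoc mult.commute)
  also have "mat_adjoint W *\<^sub>v (e \<cdot>\<^sub>v col W 0) = e \<cdot>\<^sub>v (mat_adjoint W *\<^sub>v col W 0)"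
    by (rule mult_mat_vec[of _ n n]) (use W W' n in auto)
  also have "mat_adjoint W *\<^sub>v col W 0 = col (mat_adjoint W * W) 0"
    using W W' n by (intro col_mult2[of _ n n _ n, symmetric]) auto
  finally have col0: "col A' 0 = e \<cdot>\<^sub>v unit_vec n 0" using WW n by simp
  have A'0: "A' $$ (i, 0) = (if i = 0 then e else 0)" if "i < n" for i
    using arg_cong[OF col0, of "\<lambda>w. w $ i"] that A' n by (simp split: if_splits)
  obtain A1 A2 A0 A3 where split: "split_block A' 1 1 = (A1, A2, A0, A3)"
    by (cases "split_block A' 1 1") auto
  have "dim_row A' = 1 + m" "dim_col A' = 1 + m" using A' nm by auto
  note sb = split_block[OF split this]
  have A1: "A1 = mat 1 1 (\<lambda>_. e)" and A0: "A0 = 0\<^sub>m m 1"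
    using split[unfolded split_block_def Let_def] A'0 A' nm by (auto intro!: eq_matI)
  have A1c: "A1 \<in> carrier_mat 1 1" unfolding A1 by auto
  \<comment> \<open>\<open>A'\<close> is block triangular because its first column is
    \<open>e\<close> times a unit vector, so the factor for \<open>e\<close> cancels and the
    induction hypothesis applies to \<open>A3\<close>.\<close>
  have "char_poly A' = char_poly A1 * char_poly A3"
    unfolding sb(5) A0 by (rule char_poly_four_block_zeros_col[OF A1c sb(2,4)])
  moreover have "char_poly A1 = [: -e,1 :]"
    by (simp add: A1 char_poly_defs det_def sign_def)
  moreover have "char_poly A' = char_poly A"
    by (rule char_poly_similar) (use wit in \<open>auto simp: similar_mat_def\<close>)
  ultimately have "char_poly A3 = (\<Prod>e\<leftarrow>es. [:- e, 1:])"
    using cp by (metis mult_cancel_left pCons_eq_0_iff zero_neq_one)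
  then obtain T U where IH: "similar_mat_wit A3 T U (mat_adjoint U)"
      and ut: "upper_triangular T" and diag: "diag_mat T = es"
    using Cons.IH[OF sb(4)] by blast
  note wU = similar_mat_witD2[OF sb(4) IH]
  let ?P = "four_block_mat (1\<^sub>m 1) (0\<^sub>m 1 m) (0\<^sub>m m 1) U"
  let ?T = "four_block_mat A1 (A2 * U) A0 T"
  have P: "?P \<in> carrier_mat n n" using wU unfolding nm by (intro four_block_carrier_mat) auto
  have "similar_mat_wit A' ?T ?P (four_block_mat (1\<^sub>m 1) (0\<^sub>m 1 m) (0\<^sub>m m 1) (mat_adjoint U))"
    unfolding sb(5)
    by (rule similar_mat_wit_four_block[OF similar_mat_wit_refl[OF A1c] IH _ _ A1c sb(4) sb(3)])
      (use wU sb A0 in auto)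
  then have "similar_mat_wit A' ?T ?P (mat_adjoint ?P)"
    using mat_adjoint_four_block[of U m] wU by simp
  then have "similar_mat_wit A ?T (W * ?P) (mat_adjoint (W * ?P))"
    using similar_mat_wit_trans[OF sim] mat_adjoint_mult[OF W P] by metis
  moreover have "upper_triangular ?T" unfolding A0
    by (intro upper_triangular_four_block[OF _ wU(5) _ ut]) (auto simp: A1)
  moreover have "diag_mat ?T = e # es"
    using diag_four_block_mat[OF A1c wU(5)] diag by (simp add: A1 diag_mat_def)
  ultimately show ?case by blast
qed

section \<open>Column norms, the Frobenius norm and determinants\<close>

lemma index_mult_mat_sum:
  assumes "A \<in> carrier_mat m n" "B \<in> carrier_mat n p" "i < m" "j < p"
  shows "(A * B) $$ (i, j) = (\<Sum>k<n. A $$ (i, k) * B $$ (k, j))"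
  using assms by (auto simp: scalar_prod_def lessThan_atLeast0)

lemma adjoint_mult_self_diag:
  fixes A :: "complex mat"
  assumes A: "A \<in> carrier_mat m n" and j: "j < n"
  shows "(mat_adjoint A * A) $$ (j, j) = complex_of_real (\<Sum>i<m. (cmod (A $$ (i, j)))\<^sup>2)"
  using A j by (auto simp: index_mult_mat_sum[OF mat_adjoint_carrier[OF A] A j j]
      of_real_cmod_power2 mult.commute intro!: sum.cong)

lemma isometry_col_norm:
  fixes Y :: "complex mat"
  assumes Y: "Y \<in> carrier_mat m n" and YY: "mat_adjoint Y * Y = 1\<^sub>m n"
    and S: "S \<in> carrier_mat n p" and j: "j < p"
  shows "(\<Sum>i<m. (cmod ((Y * S) $$ (i, j)))\<^sup>2) = (\<Sum>k<n. (cmod (S $$ (k, j)))\<^sup>2)"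
proof -
  note Y' = mat_adjoint_carrier[OF Y] and S' = mat_adjoint_carrier[OF S]
  have YS: "Y * S \<in> carrier_mat m p" using Y S by simp
  have "mat_adjoint (Y * S) * (Y * S) = mat_adjoint S * (mat_adjoint Y * (Y * S))"
    unfolding mat_adjoint_mult[OF Y S] by (rule assoc_mult_mat[OF S' Y' YS])
  also have "mat_adjoint Y * (Y * S) = S"
    using assoc_mult_mat[OF Y' Y S] YY S by simp
  finally have "mat_adjoint (Y * S) * (Y * S) = mat_adjoint S * S" .
  then show ?thesis
    using adjoint_mult_self_diag[OF YS j] adjoint_mult_self_diag[OF S j] by (metis of_real_eq_iff)
qed

lemma unitary_witD:
  fixes A :: "complex mat"
  assumes A: "A \<in> carrier_mat n n" and w: "similar_mat_wit A T U (mat_adjoint U)"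
  shows "U \<in> carrier_mat n n" "T \<in> carrier_mat n n" "mat_adjoint U * U = 1\<^sub>m n"
    "U * mat_adjoint U = 1\<^sub>m n" "A * U = U * T"
proof -
  note d = similar_mat_witD2[OF A w]
  show U: "U \<in> carrier_mat n n" and T: "T \<in> carrier_mat n n" and UU: "mat_adjoint U * U = 1\<^sub>m n"
    and "U * mat_adjoint U = 1\<^sub>m n" using d by auto
  note U' = mat_adjoint_carrier[OF U]
  have "A * U = U * T * mat_adjoint U * U" using d by simp
  also have "\<dots> = U * T * (mat_adjoint U * U)" using assoc_mult_mat[of "U * T" n n, OF _ U' U] U T by simp
  finally show "A * U = U * T" using UU U T by simp
qed

text \<open>Multiplication by a unitary from the left preserves column norms; multiplication from
  the right is reduced to this by passing to adjoints, which exchanges rows and columns.\<close>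

lemma frobenius_schur:
  fixes A :: "complex mat"
  assumes A: "A \<in> carrier_mat n n" and w: "similar_mat_wit A T U (mat_adjoint U)"
  shows "(\<Sum>j<n. \<Sum>i<n. (cmod (T $$ (i, j)))\<^sup>2) = (\<Sum>j<n. \<Sum>i<n. (cmod (A $$ (i, j)))\<^sup>2)"
proof -
  note u = unitary_witD[OF A w]
  note U' = mat_adjoint_carrier[OF u(1)] and A' = mat_adjoint_carrier[OF A]
  have UU': "mat_adjoint (mat_adjoint U) = U" using u(1) by (intro eq_matI) auto
  have "(\<Sum>j<n. \<Sum>i<n. (cmod (T $$ (i, j)))\<^sup>2) = (\<Sum>j<n. \<Sum>i<n. (cmod ((A * U) $$ (i, j)))\<^sup>2)"
    unfolding u(5) using isometry_col_norm[OF u(1) u(3) u(2)] by simp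
  also have "\<dots> = (\<Sum>i<n. \<Sum>j<n. (cmod ((A * U) $$ (i, j)))\<^sup>2)" by (rule sum.swap)
  also have "\<dots> = (\<Sum>i<n. \<Sum>j<n. (cmod ((mat_adjoint U * mat_adjoint A) $$ (j, i)))\<^sup>2)"
    unfolding mat_adjoint_mult[OF A u(1), symmetric] using A u(1) by (auto intro!: sum.cong)
  also have "\<dots> = (\<Sum>i<n. \<Sum>j<n. (cmod (mat_adjoint A $$ (j, i)))\<^sup>2)"
    using isometry_col_norm[OF U' _ A'] UU' u(4) by simp
  also have "\<dots> = (\<Sum>i<n. \<Sum>j<n. (cmod (A $$ (i, j)))\<^sup>2)" using A by (auto intro!: sum.cong)
  also have "\<dots> = (\<Sum>j<n. \<Sum>i<n. (cmod (A $$ (i, j)))\<^sup>2)" by (rule sum.swap)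
  finally show ?thesis .
qed

text \<open>This follows from Schur's bound \<open>\<Sum>|\<lambda>\<^sub>i|\<^sup>2 \<le> n\<close> together with \<open>x \<le> exp (x - 1)\<close>.\<close>

lemma hadamard_normalized:
  fixes A :: "complex mat"
  assumes A: "A \<in> carrier_mat n n" and c: "\<And>j. j < n \<Longrightarrow> (\<Sum>i<n. (cmod (A $$ (i, j)))\<^sup>2) \<le> 1"
  shows "cmod (det A) \<le> 1"
proof -
  obtain es where es: "char_poly A = (\<Prod>e\<leftarrow>es. [:- e, 1:])" "length es = n"
    using char_poly_factorized[OF A] by blast
  obtain T U where w: "similar_mat_wit A T U (mat_adjoint U)" and ut: "upper_triangular T"
    and diag: "diag_mat T = es" using unitary_schur[OF A es(1)] by blast
  note u = unitary_witD[OF A w]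
  have "det A = det T" using w by (intro det_similar) (auto simp: similar_mat_def)
  also have "\<dots> = (\<Prod>i<n. T $$ (i, i))"
    unfolding det_upper_triangular[OF ut u(2)] diag_mat_def using u(2)
    by (simp add: prod.distinct_set_conv_list[symmetric] lessThan_atLeast0)
  finally have "(cmod (det A))\<^sup>2 = (\<Prod>i<n. (cmod (T $$ (i, i)))\<^sup>2)"
    by (simp add: prod_norm[symmetric] prod_power_distrib)
  also have "\<dots> \<le> (\<Prod>i<n. exp ((cmod (T $$ (i, i)))\<^sup>2 - 1))"
  proof (intro prod_mono conjI)
    fix i
    show "(cmod (T $$ (i, i)))\<^sup>2 \<le> exp ((cmod (T $$ (i, i)))\<^sup>2 - 1)"
      using exp_ge_add_one_self[of "(cmod (T $$ (i, i)))\<^sup>2 - 1"] by linarith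
  qed simp
  also have "\<dots> = exp (\<Sum>i<n. ((cmod (T $$ (i, i)))\<^sup>2 - 1))" by (simp add: exp_sum)
  also have "\<dots> \<le> exp 0"
  proof -
    have "(\<Sum>i<n. (cmod (T $$ (i, i)))\<^sup>2) \<le> (\<Sum>j<n. \<Sum>i<n. (cmod (T $$ (i, j)))\<^sup>2)"
      by (intro sum_mono member_le_sum[where f = "\<lambda>i. (cmod (T $$ (i, _)))\<^sup>2"]) auto
    also have "\<dots> \<le> (\<Sum>j<n. 1)"
      unfolding frobenius_schur[OF A w] by (intro sum_mono c) auto
    finally show ?thesis by (simp add: sum_subtractf)
  qed
  finally show ?thesis using abs_square_le_1[of "cmod (det A)"] by simp
qed

text \<open>Dividing column \<open>j\<close> by \<open>c j\<close> reduces this to the normalised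
  case. The \<open>c j\<close> are positive upper bounds rather than the norms themselves, so a zero
  column causes no division by zero.\<close>

lemma hadamard:
  fixes A :: "complex mat"
  assumes A: "A \<in> carrier_mat n n" and pos: "\<And>j. j < n \<Longrightarrow> 0 < c j"
    and c: "\<And>j. j < n \<Longrightarrow> (\<Sum>i<n. (cmod (A $$ (i, j)))\<^sup>2) \<le> (c j)\<^sup>2"
  shows "cmod (det A) \<le> (\<Prod>j<n. c j)"
proof -
  define E where "E = mat n n (\<lambda>(i, j). A $$ (i, j) / complex_of_real (c j))"
  define D where "D = mat n n (\<lambda>(i, j). if i = j then complex_of_real (c j) else 0)"
  have E: "E \<in> carrier_mat n n" and D: "D \<in> carrier_mat n n" by (auto simp: E_def D_def)
  have "A = E * D"
  proof (rule eq_matI)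
    fix i j assume "i < dim_row (E * D)" "j < dim_col (E * D)"
    then have i: "i < n" and j: "j < n" using E D by auto
    have "(E * D) $$ (i, j) = (\<Sum>k<n. if k = j then A $$ (i, j) else 0)"
      unfolding index_mult_mat_sum[OF E D i j]
      using i j pos[OF j] by (intro sum.cong) (auto simp: E_def D_def)
    then show "A $$ (i, j) = (E * D) $$ (i, j)" using j by simp
  qed (use A E D in auto)
  then have "det A = det E * det D" using det_mult[OF E D] by simp
  moreover have "det D = (\<Prod>j<n. complex_of_real (c j))"
  proof -
    have "upper_triangular D" by (auto simp: D_def)
    then show ?thesis
      by (subst det_upper_triangular[OF _ D])
        (auto simp: diag_mat_def D_def prod.distinct_set_conv_list[symmetric] lessThan_atLeast0 intro!: prod.cong)
  qed
  then have "cmod (det D) = (\<Prod>j<n. c j)"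
    using prod_nonneg[of "{..<n}" c] pos by (simp flip: of_real_prod add: less_imp_le)
  moreover have "cmod (det E) \<le> 1"
  proof (rule hadamard_normalized[OF E])
    fix j assume j: "j < n"
    have "(\<Sum>i<n. (cmod (E $$ (i, j)))\<^sup>2) = (\<Sum>i<n. (cmod (A $$ (i, j)))\<^sup>2) / (c j)\<^sup>2"
      using j by (simp add: E_def norm_divide power_divide sum_divide_distrib)
    then show "(\<Sum>i<n. (cmod (E $$ (i, j)))\<^sup>2) \<le> 1"
      using c[OF j] pos[OF j] by (simp add: divide_le_eq)
  qed
  ultimately show ?thesis
    using mult_right_mono[of "cmod (det E)" 1 "cmod (det D)", OF _ norm_ge_zero] by (simp add: norm_mult)
qed

text \<open>Double counting of the squared moduli of all entries: each of the \<open>card J\<close>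
  vectors contributes one, each coordinate at most one by Bessel's inequality.\<close>

lemma card_orthonormal_le:
  fixes w :: "'a \<Rightarrow> 'b \<Rightarrow> complex"
  assumes fin: "finite J" "finite R"
    and on: "\<And>i j. i \<in> J \<Longrightarrow> j \<in> J \<Longrightarrow> (\<Sum>x\<in>R. cnj (w x i) * w x j) = (if i = j then 1 else 0)"
  shows "card J \<le> card R"
proof -
  have bessel: "(\<Sum>j\<in>J. (cmod (w x j))\<^sup>2) \<le> 1" if x: "x \<in> R" for x
  proof -
    \<comment> \<open>Up to conjugation, \<open>G\<close> is the projection of the unit vector at
      \<open>x\<close> to the span of the family. Its value at \<open>x\<close> and its squared norm
      both equal \<open>g\<close>, whence \<open>g\<^sup>2 \<le> g\<close>.\<close>
    define G where "G y = (\<Sum>j\<in>J. w x j * cnj (w y j))" for y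
    define g where "g = (\<Sum>j\<in>J. (cmod (w x j))\<^sup>2)"
    have Gx: "G x = complex_of_real g" by (simp add: G_def g_def of_real_cmod_power2)
    have "complex_of_real (\<Sum>y\<in>R. (cmod (G y))\<^sup>2)
        = (\<Sum>y\<in>R. \<Sum>i\<in>J. \<Sum>j\<in>J. w x i * cnj (w x j) * (cnj (w y i) * w y j))"
    proof -
      have "(complex_of_real (cmod (G y)))\<^sup>2
        = (\<Sum>i\<in>J. \<Sum>j\<in>J. w x i * cnj (w x j) * (cnj (w y i) * w y j))" for y
      proof -
        have "(complex_of_real (cmod (G y)))\<^sup>2
          = (\<Sum>i\<in>J. \<Sum>j\<in>J. w x i * cnj (w y i) * (cnj (w x j) * w y j))"
          unfolding of_real_cmod_power2 by (simp add: G_def sum_product)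
        then show ?thesis by (simp add: mult_ac)
      qed
      then show ?thesis by simp
    qed
    also have "\<dots> = (\<Sum>i\<in>J. \<Sum>j\<in>J. w x i * cnj (w x j) * (\<Sum>y\<in>R. cnj (w y i) * w y j))"
      by (subst sum.swap, rule sum.cong[OF refl], subst sum.swap) (simp add: sum_distrib_left)
    also have "\<dots> = (\<Sum>i\<in>J. \<Sum>j\<in>J. if i = j then w x i * cnj (w x j) else 0)"
      using on by (intro sum.cong refl) auto
    also have "\<dots> = complex_of_real g" using fin by (simp add: g_def of_real_cmod_power2)
    finally have "(\<Sum>y\<in>R. (cmod (G y))\<^sup>2) = g" using of_real_eq_iff by blast
    moreover have "(cmod (G x))\<^sup>2 \<le> (\<Sum>y\<in>R. (cmod (G y))\<^sup>2)"
      using x fin by (intro member_le_sum[where f = "\<lambda>y. (cmod (G y))\<^sup>2"]) auto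
    ultimately have "g\<^sup>2 \<le> g" by (simp add: Gx)
    moreover have "0 \<le> g" unfolding g_def by (intro sum_nonneg) auto
    ultimately show ?thesis unfolding g_def[symmetric]
      using mult_le_cancel_left1[of g g] by (cases "g = 0") (auto simp: power2_eq_square)
  qed
  have "real (card J) = (\<Sum>j\<in>J. \<Sum>x\<in>R. (cmod (w x j))\<^sup>2)"
  proof -
    have "(\<Sum>x\<in>R. (cmod (w x j))\<^sup>2) = 1" if "j \<in> J" for j
    proof -
      have "complex_of_real (\<Sum>x\<in>R. (cmod (w x j))\<^sup>2) = 1"
        using on[OF that that] by (simp add: of_real_cmod_power2 mult.commute)
      then show ?thesis using of_real_eq_1_iff by blast
    qed
    then show ?thesis by simp
  qed
  also have "\<dots> = (\<Sum>x\<in>R. \<Sum>j\<in>J. (cmod (w x j))\<^sup>2)" by (rule sum.swap)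
  also have "\<dots> \<le> (\<Sum>x\<in>R. 1)" by (intro sum_mono bessel)
  finally show ?thesis by simp
qed

section \<open>Counting large eigenvalues\<close>

text \<open>The product is the modulus of the determinant of \<open>A\<close> on the span of its
  first \<open>n\<close> Schur vectors. In an orthonormal basis of that span of which all but at
  most \<open>card R\<close> vectors vanish on \<open>R\<close>, Hadamard's inequality bounds it
  column by column.\<close>

lemma prod_leading_eigenvalues_le:
  fixes A :: "complex mat"
  assumes A: "A \<in> carrier_mat N N" and es: "char_poly A = (\<Prod>e\<leftarrow>es. [:- e, 1:])"
    and n: "n \<le> N" and R: "R \<subseteq> {..<N}" and \<epsilon>: "0 < \<epsilon>" "\<epsilon> \<le> \<Gamma>" and rn: "card R \<le> n"
    and bounded: "\<And>f. (\<Sum>i<N. (cmod (\<Sum>k<N. A $$ (i, k) * f k))\<^sup>2) \<le> \<Gamma>\<^sup>2 * (\<Sum>k<N. (cmod (f k))\<^sup>2)"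
    and small: "\<And>f. (\<forall>k\<in>R. f k = 0) \<Longrightarrow>
      (\<Sum>i<N. (cmod (\<Sum>k<N. A $$ (i, k) * f k))\<^sup>2) \<le> \<epsilon>\<^sup>2 * (\<Sum>k<N. (cmod (f k))\<^sup>2)"
  shows "(\<Prod>i<n. cmod (es ! i)) \<le> \<Gamma> ^ card R * \<epsilon> ^ (n - card R)"
proof -
  obtain T U where w: "similar_mat_wit A T U (mat_adjoint U)" and ut: "upper_triangular T"
    and diag: "diag_mat T = es" using unitary_schur[OF A es] by blast
  note u = unitary_witD[OF A w]
  have finR: "finite R" using R finite_subset by blast
  define Q where "Q = mat N n (\<lambda>(i, j). U $$ (i, j))"
  define Tn where "Tn = mat n n (\<lambda>(i, j). T $$ (i, j))"
  have Q: "Q \<in> carrier_mat N n" and Tn: "Tn \<in> carrier_mat n n" by (auto simp: Q_def Tn_def)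
  note Q' = mat_adjoint_carrier[OF Q]
  have QQ: "mat_adjoint Q * Q = 1\<^sub>m n"
  proof (rule eq_matI)
    fix i j assume "i < dim_row (1\<^sub>m n :: complex mat)" "j < dim_col (1\<^sub>m n :: complex mat)"
    then have i: "i < n" and j: "j < n" by auto
    have "(mat_adjoint Q * Q) $$ (i, j) = (\<Sum>k<N. cnj (U $$ (k, i)) * U $$ (k, j))"
      unfolding index_mult_mat_sum[OF Q' Q i j] using i j by (intro sum.cong) (auto simp: Q_def)
    also have "\<dots> = (mat_adjoint U * U) $$ (i, j)"
      using i j n u(1) index_mult_mat_sum[OF mat_adjoint_carrier[OF u(1)] u(1), of i j]
      by (auto intro!: sum.cong)
    finally show "(mat_adjoint Q * Q) $$ (i, j) = 1\<^sub>m n $$ (i, j)" using u(3) i j n by simp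
  qed (use Q in auto)
  \<comment> \<open>Upper triangularity of \<open>T\<close> makes the span of the first
    \<open>n\<close> columns of \<open>U\<close> invariant under \<open>A\<close>, with matrix
    \<open>Tn\<close>.\<close>
  have AQ: "A * Q = Q * Tn"
  proof (rule eq_matI)
    fix i j assume "i < dim_row (Q * Tn)" "j < dim_col (Q * Tn)"
    then have i: "i < N" and j: "j < n" using Q Tn by auto
    have "(A * Q) $$ (i, j) = (A * U) $$ (i, j)"
      unfolding index_mult_mat_sum[OF A Q i j] using i j n
      by (subst index_mult_mat_sum[OF A u(1)]) (auto simp: Q_def)
    also have "\<dots> = (\<Sum>k<N. U $$ (i, k) * T $$ (k, j))"
      unfolding u(5) using i j n by (subst index_mult_mat_sum[OF u(1,2)]) auto
    also have "\<dots> = (\<Sum>k<n. U $$ (i, k) * T $$ (k, j))"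
      using n j ut u(2) by (intro sum.mono_neutral_right) (auto simp: upper_triangular_def)
    also have "\<dots> = (Q * Tn) $$ (i, j)"
      unfolding index_mult_mat_sum[OF Q Tn i j] using i j by (intro sum.cong) (auto simp: Q_def Tn_def)
    finally show "(A * Q) $$ (i, j) = (Q * Tn) $$ (i, j)" .
  qed (use A Q Tn in auto)
  text \<open>Diagonalising the compression of the coordinate projection onto \<open>R\<close> to the invariant
    subspace: at most \<open>card R\<close> of the resulting orthonormal basis vectors do not vanish on \<open>R\<close>.\<close>
  define H where "H = mat n n (\<lambda>(i, j). \<Sum>x\<in>R. cnj (Q $$ (x, i)) * Q $$ (x, j))"
  have H: "H \<in> carrier_mat n n" by (auto simp: H_def)
  obtain fs where "char_poly H = (\<Prod>e\<leftarrow>fs. [:- e, 1:])" using char_poly_factorized[OF H] by blast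
  then obtain L V where wH: "similar_mat_wit H L V (mat_adjoint V)" and uL: "upper_triangular L"
    using unitary_schur[OF H] by blast
  note v = unitary_witD[OF H wH]
  note V' = mat_adjoint_carrier[OF v(1)]
  define Y where "Y = Q * V"
  have Y: "Y \<in> carrier_mat N n" using Q v by (simp add: Y_def)
  note Y' = mat_adjoint_carrier[OF Y]
  have Yi: "Y $$ (x, i) = (\<Sum>k<n. Q $$ (x, k) * V $$ (k, i))" if "x < N" "i < n" for x i
    unfolding Y_def using that by (rule index_mult_mat_sum[OF Q v(1)])
  have L: "(\<Sum>x\<in>R. cnj (Y $$ (x, i)) * Y $$ (x, j)) = L $$ (i, j)" if i: "i < n" and j: "j < n" for i j
  proof -
    have "L = mat_adjoint V * (H * V)"
      unfolding v(5) using v assoc_mult_mat[OF V' v(1) v(2)] by simp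
    then have "L $$ (i, j) = (\<Sum>k<n. mat_adjoint V $$ (i, k) * (H * V) $$ (k, j))"
      using index_mult_mat_sum[OF V' _ i j] H v(1) by simp
    also have "\<dots> = (\<Sum>k<n. cnj (V $$ (k, i)) * (\<Sum>l<n. H $$ (k, l) * V $$ (l, j)))"
      using i j v(1) index_mult_mat_sum[OF H v(1)] by (intro sum.cong) auto
    also have "\<dots> = (\<Sum>k<n. \<Sum>l<n. \<Sum>x\<in>R. cnj (V $$ (k, i)) * (cnj (Q $$ (x, k)) * (Q $$ (x, l) * V $$ (l, j))))"
      by (auto simp: H_def sum_distrib_left sum_distrib_right mult.assoc intro!: sum.cong)
    also have "\<dots> = (\<Sum>k<n. \<Sum>x\<in>R. \<Sum>l<n. cnj (V $$ (k, i)) * (cnj (Q $$ (x, k)) * (Q $$ (x, l) * V $$ (l, j))))"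
      by (rule sum.cong[OF refl], rule sum.swap)
    also have "\<dots> = (\<Sum>x\<in>R. \<Sum>k<n. \<Sum>l<n. cnj (V $$ (k, i)) * (cnj (Q $$ (x, k)) * (Q $$ (x, l) * V $$ (l, j))))"
      by (rule sum.swap)
    also have "\<dots> = (\<Sum>x\<in>R. cnj (Y $$ (x, i)) * Y $$ (x, j))"
    proof (rule sum.cong[OF refl])
      fix x assume "x \<in> R"
      then have "cnj (Y $$ (x, i)) * Y $$ (x, j)
          = (\<Sum>k<n. \<Sum>l<n. (cnj (Q $$ (x, k)) * cnj (V $$ (k, i))) * (Q $$ (x, l) * V $$ (l, j)))"
        using R i j by (auto simp: Yi sum_product)
      then show "(\<Sum>k<n. \<Sum>l<n. cnj (V $$ (k, i)) * (cnj (Q $$ (x, k)) * (Q $$ (x, l) * V $$ (l, j))))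
          = cnj (Y $$ (x, i)) * Y $$ (x, j)" by (simp add: mult_ac)
    qed
    finally show ?thesis by simp
  qed
  define q where "q j = (\<Sum>x\<in>R. (cmod (Y $$ (x, j)))\<^sup>2)" for j
  have Lq: "L $$ (j, j) = complex_of_real (q j)" if "j < n" for j
    using L[OF that that] by (simp add: q_def of_real_cmod_power2 mult.commute)
  \<comment> \<open>\<open>L\<close> is upper triangular, and Hermitian as a Gram matrix over
    \<open>R\<close>; hence it is diagonal.\<close>
  have Loff: "L $$ (i, j) = 0" if "i < n" "j < n" "i \<noteq> j" for i j
  proof (cases "j < i")
    case True then show ?thesis using uL that v(2) by (auto simp: upper_triangular_def)
  next
    case False
    then have "L $$ (j, i) = 0" using uL that v(2) by (auto simp: upper_triangular_def)
    moreover have "L $$ (i, j) = cnj (L $$ (j, i))"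
      by (simp add: L[OF that(1,2), symmetric] L[OF that(2,1), symmetric] mult.commute)
    ultimately show ?thesis by simp
  qed
  define J where "J = {j. j < n \<and> q j \<noteq> 0}"
  have q0: "0 \<le> q j" for j unfolding q_def by (intro sum_nonneg) auto
  have finJ: "finite J" and Jn: "J \<subseteq> {..<n}" by (auto simp: J_def)
  \<comment> \<open>Restricted to \<open>R\<close>, the columns of \<open>Y\<close> are orthogonal
    with squared norms \<open>q j\<close>; the nonzero ones, normalised, form an orthonormal family
    on \<open>R\<close>.\<close>
  have cardJ: "card J \<le> card R"
  proof (rule card_orthonormal_le[OF finJ finR, where w = "\<lambda>x j. Y $$ (x, j) / complex_of_real (sqrt (q j))"])
    fix i j assume "i \<in> J" "j \<in> J"
    then have i: "i < n" "q i > 0" and j: "j < n" "q j > 0" using q0 by (auto simp: J_def less_le)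
    have "(\<Sum>x\<in>R. cnj (Y $$ (x, i) / complex_of_real (sqrt (q i))) * (Y $$ (x, j) / complex_of_real (sqrt (q j))))
      = L $$ (i, j) / (complex_of_real (sqrt (q i)) * complex_of_real (sqrt (q j)))"
      by (simp add: L[OF i(1) j(1), symmetric] sum_divide_distrib)
    also have "\<dots> = (if i = j then 1 else 0)"
      using i j Loff[OF i(1) j(1)] by (auto simp: Lq simp flip: of_real_mult)
    finally show "(\<Sum>x\<in>R. cnj (Y $$ (x, i) / complex_of_real (sqrt (q i))) * (Y $$ (x, j) / complex_of_real (sqrt (q j))))
      = (if i = j then 1 else 0)" .
  qed
  have YY: "mat_adjoint Y * Y = 1\<^sub>m n"
  proof -
    have "mat_adjoint Y * Y = mat_adjoint V * (mat_adjoint Q * (Q * V))"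
      unfolding Y_def mat_adjoint_mult[OF Q v(1)] using assoc_mult_mat[OF V' Q', of "Q * V" n] Q v(1) by simp
    also have "mat_adjoint Q * (Q * V) = V" using assoc_mult_mat[OF Q' Q v(1)] QQ v(1) by simp
    finally show ?thesis using v(3) by simp
  qed
  define S where "S = mat_adjoint V * Tn * V"
  have S: "S \<in> carrier_mat n n" using V' Tn v(1) by (simp add: S_def)
  have VS: "V * S = Tn * V"
  proof -
    have "V * S = V * (mat_adjoint V * (Tn * V))"
      unfolding S_def using assoc_mult_mat[OF V' Tn v(1)] by simp
    also have "\<dots> = (V * mat_adjoint V) * (Tn * V)"
      using assoc_mult_mat[OF v(1) V', of "Tn * V" n] Tn v(1) by simp
    finally show ?thesis using v(4) Tn v(1) by simp
  qed
  have AY: "A * Y = Y * S"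
  proof -
    have "A * Y = (Q * Tn) * V" unfolding Y_def AQ[symmetric] using assoc_mult_mat[OF A Q v(1)] by simp
    also have "\<dots> = Q * (V * S)" unfolding VS using assoc_mult_mat[OF Q Tn v(1)] .
    also have "\<dots> = Y * S" unfolding Y_def using assoc_mult_mat[OF Q v(1) S] by simp
    finally show ?thesis .
  qed
  have Ycol: "(\<Sum>x<N. (cmod (Y $$ (x, j)))\<^sup>2) = 1" if j: "j < n" for j
  proof -
    have "complex_of_real (\<Sum>x<N. (cmod (Y $$ (x, j)))\<^sup>2) = 1"
      using adjoint_mult_self_diag[OF Y j] YY j by simp
    then show ?thesis using of_real_eq_1_iff by blast
  qed
  \<comment> \<open>\<open>S\<close> is the matrix of \<open>A\<close> in the basis
    \<open>Y\<close>. Since \<open>Y\<close> is an isometry, the column norms of \<open>S\<close>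
    are the norms of \<open>A\<close> applied to the basis vectors.\<close>
  have Scol: "(\<Sum>k<n. (cmod (S $$ (k, j)))\<^sup>2) = (\<Sum>i<N. (cmod (\<Sum>k<N. A $$ (i, k) * Y $$ (k, j)))\<^sup>2)"
    if j: "j < n" for j
    unfolding isometry_col_norm[OF Y YY S j, symmetric] AY[symmetric]
    using index_mult_mat_sum[OF A Y _ j] by simp
  define c where "c j = (if j \<in> J then \<Gamma> else \<epsilon>)" for j
  have "cmod (det S) \<le> (\<Prod>j<n. c j)"
  proof (rule hadamard[OF S])
    fix j assume j: "j < n"
    show "0 < c j" using \<epsilon> by (auto simp: c_def)
    show "(\<Sum>i<n. (cmod (S $$ (i, j)))\<^sup>2) \<le> (c j)\<^sup>2"
    proof (cases "j \<in> J")
      case True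
      then show ?thesis using bounded[of "\<lambda>k. Y $$ (k, j)"] by (simp add: Scol[OF j] Ycol[OF j] c_def)
    next
      case False
      then have "q j = 0" using j by (simp add: J_def)
      then have "\<forall>k\<in>R. Y $$ (k, j) = 0"
        unfolding q_def using finR by (subst (asm) sum_nonneg_eq_0_iff) auto
      then show ?thesis using False small[of "\<lambda>k. Y $$ (k, j)"]
        by (simp add: Scol[OF j] Ycol[OF j] c_def)
    qed
  qed
  also have "(\<Prod>j<n. c j) = \<Gamma> ^ card J * \<epsilon> ^ (n - card J)"
  proof -
    have "(\<Prod>j<n. c j) = (\<Prod>j\<in>J. c j) * (\<Prod>j\<in>{..<n} - J. c j)"
      using prod.subset_diff[OF Jn, of c] by (simp add: mult.commute)
    then show ?thesis using Jn finJ by (simp add: c_def card_Diff_subset)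
  qed
  \<comment> \<open>\<open>card J\<close> may fall short of \<open>card R\<close>; as
    \<open>\<epsilon> \<le> \<Gamma>\<close>, the surplus factors \<open>\<epsilon>\<close> are
    raised to \<open>\<Gamma>\<close>.\<close>
  also have "\<dots> \<le> \<Gamma> ^ card R * \<epsilon> ^ (n - card R)"
  proof -
    have "\<Gamma> ^ card J * \<epsilon> ^ (n - card J) = \<Gamma> ^ card J * \<epsilon> ^ (card R - card J) * \<epsilon> ^ (n - card R)"
      using cardJ rn by (simp add: mult.assoc power_add[symmetric])
    also have "\<dots> \<le> \<Gamma> ^ card J * \<Gamma> ^ (card R - card J) * \<epsilon> ^ (n - card R)"
      using \<epsilon> by (intro mult_right_mono mult_left_mono power_mono) auto
    finally show ?thesis using cardJ by (simp add: power_add[symmetric])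
  qed
  also have "cmod (det S) = (\<Prod>i<n. cmod (es ! i))"
  proof -
    have "similar_mat_wit Tn S V (mat_adjoint V)"
    proof (rule similar_mat_witI[OF v(4) v(3) _ Tn S v(1) V'])
      show "Tn = V * S * mat_adjoint V"
        unfolding VS using assoc_mult_mat[OF Tn v(1) V'] v(4) Tn by simp
    qed
    then have "det S = det Tn" by (metis det_similar similar_mat_def)
    moreover have utn: "upper_triangular Tn" using ut n u(2) by (auto simp: upper_triangular_def Tn_def)
    ultimately have "det S = (\<Prod>i<n. Tn $$ (i, i))"
      unfolding det_upper_triangular[OF utn Tn] diag_mat_def using Tn
      by (simp add: prod.distinct_set_conv_list[symmetric] lessThan_atLeast0)
    also have "\<dots> = (\<Prod>i<n. es ! i)"
      unfolding diag[symmetric] diag_mat_def using n u(2) by (auto simp: Tn_def intro!: prod.cong)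
    finally show ?thesis by (simp add: prod_norm)
  qed
  finally show ?thesis .
qed

lemma order_prod_linear: "Polynomial.order z (\<Prod>e\<leftarrow>es. [:- e, 1:]) = count_list es (z :: complex)"
proof (induction es)
  case (Cons e es)
  have "(\<Prod>e\<leftarrow>es. [:- e, 1:]) \<noteq> (0 :: complex poly)" by (auto simp: prod_list_zero_iff)
  then have "[:- e, 1:] * (\<Prod>e\<leftarrow>es. [:- e, 1:]) \<noteq> 0" by (simp del: mult_pCons_left)
  then show ?case using Cons by (simp add: order_mult order_linear' del: mult_pCons_left)
qed simp

text \<open>Passing from multiplicities to a list makes it possible to move the counted eigenvalues
  to the front.\<close>

lemma sum_order_eq_length_filter:
  fixes p :: "complex poly"
  assumes p: "p = (\<Prod>e\<leftarrow>es. [:- e, 1:])"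
  shows "(\<Sum>z\<in>{z. poly p z = 0 \<and> P z}. Polynomial.order z p) = length (filter P es)"
proof -
  have root: "poly p z = 0 \<longleftrightarrow> z \<in> set es" for z
    unfolding p by (auto simp: poly_prod_list prod_list_zero_iff)
  have "(\<Sum>z\<in>{z. poly p z = 0 \<and> P z}. Polynomial.order z p)
      = (\<Sum>z\<in>set (filter P es). count_list (filter P es) z)"
  proof (rule sum.cong)
    fix z assume "z \<in> set (filter P es)"
    then have "P z" by simp
    then have "count_list es z = count_list (filter P es) z" by (induction es) auto
    then show "Polynomial.order z p = count_list (filter P es) z"
      unfolding p order_prod_linear .
  qed (auto simp: root)
  then show ?thesis by (simp add: sum_count_set)
qed

text \<open>The large eigenvalues span an invariant subspace; the volume factor of the matrix on it is
  the product of these eigenvalues.\<close>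

lemma eigenvalue_count_bound:
  fixes A :: "complex mat"
  assumes A: "A \<in> carrier_mat N N"
    and R: "R \<subseteq> {..<N}" and \<epsilon>: "0 < \<epsilon>" "\<epsilon> \<le> \<Gamma>" and \<eta>: "0 \<le> \<eta>"
    and bounded: "\<And>f. (\<Sum>i<N. (cmod (\<Sum>k<N. A $$ (i, k) * f k))\<^sup>2) \<le> \<Gamma>\<^sup>2 * (\<Sum>k<N. (cmod (f k))\<^sup>2)"
    and small: "\<And>f. (\<forall>k\<in>R. f k = 0) \<Longrightarrow>
      (\<Sum>i<N. (cmod (\<Sum>k<N. A $$ (i, k) * f k))\<^sup>2) \<le> \<epsilon>\<^sup>2 * (\<Sum>k<N. (cmod (f k))\<^sup>2)"
  defines "n \<equiv> \<Sum>z\<in>{z. poly (char_poly A) z = 0 \<and> \<eta> \<le> cmod z}. Polynomial.order z (char_poly A)"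
  shows "n \<le> N" and "card R \<le> n \<Longrightarrow> \<eta> ^ n \<le> \<Gamma> ^ card R * \<epsilon> ^ (n - card R)"
proof -
  obtain fs where fs: "char_poly A = (\<Prod>e\<leftarrow>fs. [:- e, 1:])" "length fs = N"
    using char_poly_factorized[OF A] by blast
  let ?P = "\<lambda>z. \<eta> \<le> cmod z"
  \<comment> \<open>Large eigenvalues first: Schur triangularisation realises any order, so the
    first \<open>n\<close> diagonal entries are the large ones.\<close>
  define es where "es = filter ?P fs @ filter (\<lambda>z. \<not> ?P z) fs"
  have nf: "n = length (filter ?P fs)"
    unfolding n_def by (rule sum_order_eq_length_filter[OF fs(1)])
  show nN: "n \<le> N" unfolding nf fs(2)[symmetric] by simp
  have ces: "char_poly A = (\<Prod>e\<leftarrow>es. [:- e, 1:])"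
  proof -
    have "mset fs = mset es" by (simp add: es_def)
    then have "mset (map (\<lambda>e. [:- e, 1:]) fs) = mset (map (\<lambda>e. [:- e, 1:]) es)" by simp
    then show ?thesis unfolding fs(1) by (metis prod_mset_prod_list)
  qed
  assume rn: "card R \<le> n"
  have "\<eta> ^ n = (\<Prod>i<n. \<eta>)" by simp
  also have "\<dots> \<le> (\<Prod>i<n. cmod (es ! i))"
  proof (intro prod_mono conjI \<eta>)
    fix i assume "i \<in> {..<n}"
    then have "es ! i \<in> set (filter ?P fs)" unfolding es_def nf by (auto simp: nth_append simp del: set_filter)
    then show "\<eta> \<le> cmod (es ! i)" by simp
  qed
  also have "\<dots> \<le> \<Gamma> ^ card R * \<epsilon> ^ (n - card R)"
    by (rule prod_leading_eigenvalues_le[OF A ces nN R \<epsilon> rn bounded small])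
  finally show "\<eta> ^ n \<le> \<Gamma> ^ card R * \<epsilon> ^ (n - card R)" .
qed

section \<open>Exponential sums of Gevrey functions\<close>

text \<open>A backward difference extends the support only to the right, so sums over
  \<open>l \<ge> 0\<close> acquire no boundary term at the left end.\<close>

definition bdiff :: "real \<Rightarrow> (real \<Rightarrow> real) \<Rightarrow> real \<Rightarrow> real" where
  "bdiff h f = (\<lambda>x. f x - f (x - h))"

lemma smooth_fun_has_derivative:
  assumes "smooth_fun f"
  shows "((deriv ^^ k) f has_real_derivative (deriv ^^ Suc k) f x) (at x)"
  using assms by (auto simp: smooth_fun_def DERIV_deriv_iff_real_differentiable)

lemma bdiff_has_derivative:
  assumes "\<And>x. (g has_real_derivative g' x) (at x)"
  shows "(bdiff h g has_real_derivative bdiff h g' x) (at x)"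
proof -
  have "((\<lambda>x. g (x - h)) has_real_derivative g' (x - h) * 1) (at x)"
    by (rule DERIV_chain2[OF assms]) (auto intro!: derivative_eq_intros)
  then show ?thesis unfolding bdiff_def using DERIV_diff[OF assms] by simp
qed

lemma funpow_deriv_bdiff:
  assumes "smooth_fun f"
  shows "(deriv ^^ k) (bdiff h f) = bdiff h ((deriv ^^ k) f)"
proof (induction k)
  case (Suc k)
  have "deriv (bdiff h ((deriv ^^ k) f)) = bdiff h ((deriv ^^ Suc k) f)"
    by (intro ext DERIV_imp_deriv bdiff_has_derivative smooth_fun_has_derivative assms)
  then show ?case using Suc by simp
qed simp

lemma smooth_fun_bdiff:
  assumes "smooth_fun f"
  shows "smooth_fun (bdiff h f)"
  unfolding smooth_fun_def funpow_deriv_bdiff[OF assms]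
  using bdiff_has_derivative[OF smooth_fun_has_derivative[OF assms]] real_differentiable_def by blast

text \<open>Differences commute with derivatives, so each difference in turn trades one derivative
  for a factor \<open>h\<close> by the mean value inequality.\<close>

lemma funpow_bdiff_bound:
  assumes "smooth_fun f" "0 \<le> h" "\<And>x. \<bar>(deriv ^^ \<alpha>) f x\<bar> \<le> B"
  shows "\<bar>(bdiff h ^^ \<alpha>) f x\<bar> \<le> h ^ \<alpha> * B"
  using assms
proof (induction \<alpha> arbitrary: f B)
  case (Suc \<alpha>)
  have "\<bar>(deriv ^^ \<alpha>) (bdiff h f) y\<bar> \<le> h * B" for y
  proof -
    have "norm ((deriv ^^ \<alpha>) f y - (deriv ^^ \<alpha>) f (y - h)) \<le> B * norm (y - (y - h))"
      by (rule field_differentiable_bound[of UNIV _ "(deriv ^^ Suc \<alpha>) f"])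
        (use Suc.prems smooth_fun_has_derivative[OF Suc.prems(1)] in auto)
    then show ?thesis
      unfolding funpow_deriv_bdiff[OF Suc.prems(1)] using Suc.prems(2) by (simp add: bdiff_def mult.commute)
  qed
  from Suc.IH[OF smooth_fun_bdiff[OF Suc.prems(1)] Suc.prems(2) this]
  show ?case by (simp add: funpow_swap1 mult_ac)
qed simp

lemma funpow_bdiff_support:
  assumes f: "\<And>x. x \<le> 0 \<or> 1 \<le> x \<Longrightarrow> f x = 0" and h: "0 \<le> h"
  shows "x \<le> 0 \<or> 1 + real \<alpha> * h \<le> x \<Longrightarrow> (bdiff h ^^ \<alpha>) f x = 0"
proof (induction \<alpha> arbitrary: x)
  case (Suc \<alpha>)
  then have "x \<le> 0 \<or> 1 + real \<alpha> * h \<le> x" "x - h \<le> 0 \<or> 1 + real \<alpha> * h \<le> x - h"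
    using h by (auto simp: algebra_simps)
  then show ?case using Suc.IH by (simp add: bdiff_def)
qed (use f in auto)

text \<open>Multiplication by \<open>1 - z\<close> shifts the index and turns coefficients into
  backward differences. Boundary terms vanish by the support property, and each step lengthens the
  range by one index.\<close>

lemma summation_by_parts_iterated:
  fixes z :: complex
  assumes f: "\<And>x. x \<le> 0 \<or> 1 \<le> x \<Longrightarrow> f x = 0" and K: "0 < K"
  shows "(1 - z) ^ \<alpha> * (\<Sum>l<K. complex_of_real (f (real l / real K)) * z ^ l)
    = (\<Sum>l<K + \<alpha>. complex_of_real ((bdiff (1 / real K) ^^ \<alpha>) f (real l / real K)) * z ^ l)"
proof (induction \<alpha>)
  case (Suc \<alpha>)
  define h where "h = 1 / real K"
  define G where "G = (bdiff h ^^ \<alpha>) f"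
  have h: "0 \<le> h" by (simp add: h_def)
  have Gz: "G x = 0" if "x \<le> 0 \<or> 1 + real \<alpha> * h \<le> x" for x
    unfolding G_def using funpow_bdiff_support[OF f h that] .
  let ?n = "K + \<alpha>"
  have "real ?n / real K = 1 + real \<alpha> * h" using K by (simp add: h_def field_simps)
  then have Gn: "G (real ?n / real K) = 0" using Gz by simp
  have "(\<Sum>l<Suc ?n. complex_of_real (bdiff h G (real l / real K)) * z ^ l)
    = (\<Sum>l<Suc ?n. complex_of_real (G (real l / real K)) * z ^ l)
      - (\<Sum>l<Suc ?n. complex_of_real (G (real l / real K - h)) * z ^ l)"
    by (simp add: bdiff_def sum_subtractf algebra_simps)
  also have "(\<Sum>l<Suc ?n. complex_of_real (G (real l / real K)) * z ^ l)
    = (\<Sum>l<?n. complex_of_real (G (real l / real K)) * z ^ l)" using Gn by simp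
  also have "(\<Sum>l<Suc ?n. complex_of_real (G (real l / real K - h)) * z ^ l)
    = (\<Sum>l<?n. complex_of_real (G (real (Suc l) / real K - h)) * z ^ Suc l)"
    unfolding sum.lessThan_Suc_shift using Gz[of "-h"] h by simp
  also have "\<dots> = z * (\<Sum>l<?n. complex_of_real (G (real l / real K)) * z ^ l)"
    unfolding sum_distrib_left by (intro sum.cong) (auto simp: h_def add_divide_distrib)
  finally have "(\<Sum>l<Suc ?n. complex_of_real (bdiff h G (real l / real K)) * z ^ l)
    = (1 - z) * (\<Sum>l<?n. complex_of_real (G (real l / real K)) * z ^ l)" by (simp add: algebra_simps)
  then show ?case using Suc unfolding G_def h_def by (simp add: mult.assoc)
qed simp

text \<open>All derivatives vanish off the compact support, which makes the local Gevrey constant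
  global; compactness also keeps the support at a distance \<open>\<kappa>\<close> from 0 and
  1.\<close>

lemma gevrey_c01_bounds:
  assumes g: "gevrey_c01 s f"
  shows "\<exists>C \<kappa>. 1 \<le> C \<and> 0 < \<kappa> \<and> \<kappa> \<le> 1 / 4 \<and> (\<forall>x. f x \<noteq> 0 \<longrightarrow> \<kappa> \<le> x \<and> x \<le> 1 - \<kappa>) \<and>
    (\<forall>\<alpha> x. \<bar>(deriv ^^ \<alpha>) f x\<bar> \<le> C ^ (\<alpha> + 1) * fact \<alpha> powr s)"
proof -
  let ?S = "closure {x. f x \<noteq> 0}"
  have sub: "?S \<subseteq> {0<..<1}" and comp: "compact ?S"
    and bd: "\<And>K'. compact K' \<Longrightarrow> \<exists>C. \<forall>\<alpha>::nat. \<forall>x\<in>K'. \<bar>(deriv ^^ \<alpha>) f x\<bar> \<le> C ^ (\<alpha> + 1) * fact \<alpha> powr s"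
    using g unfolding gevrey_c01_def by auto
  obtain C where C: "\<And>\<alpha> x. x \<in> ?S \<Longrightarrow> \<bar>(deriv ^^ \<alpha>) f x\<bar> \<le> C ^ (\<alpha> + 1) * fact \<alpha> powr s"
    using bd[OF comp] by blast
  have out: "\<forall>x. x \<notin> ?S \<longrightarrow> (deriv ^^ \<alpha>) f x = 0" for \<alpha>
  proof (induction \<alpha>)
    case 0
    then show ?case using closure_subset[of "{x. f x \<noteq> 0}"] by auto
  next
    case (Suc \<alpha>)
    show ?case
    proof (intro allI impI)
      fix x assume x: "x \<notin> ?S"
      have "((deriv ^^ \<alpha>) f has_real_derivative 0) (at x)"
        by (rule has_field_derivative_transform_within_open[of "\<lambda>_. 0" _ _ "- ?S"])
          (use Suc x in auto)
      then show "(deriv ^^ Suc \<alpha>) f x = 0" by (simp add: DERIV_imp_deriv)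
    qed
  qed
  define C' where "C' = max 1 \<bar>C\<bar>"
  have b: "\<bar>(deriv ^^ \<alpha>) f x\<bar> \<le> C' ^ (\<alpha> + 1) * fact \<alpha> powr s" for \<alpha> x
  proof (cases "x \<in> ?S")
    case True
    have "C ^ (\<alpha> + 1) \<le> \<bar>C\<bar> ^ (\<alpha> + 1)" by (metis abs_ge_self power_abs)
    also have "\<dots> \<le> C' ^ (\<alpha> + 1)" unfolding C'_def by (intro power_mono) auto
    finally show ?thesis using C[OF True, of \<alpha>] by (meson mult_right_mono order_trans powr_ge_zero)
  next
    case False
    then show ?thesis using out[of \<alpha>] by (auto simp: C'_def)
  qed
  obtain a b where ab: "0 < a" "b < 1" "?S \<subseteq> {a..b}"
  proof (cases "?S = {}")
    case True then show ?thesis using that[of "1/2" "1/2"] by auto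
  next
    case False
    obtain a where a: "a \<in> ?S" "\<forall>x\<in>?S. a \<le> x" using compact_attains_inf[OF comp False] by blast
    obtain b where b: "b \<in> ?S" "\<forall>x\<in>?S. x \<le> b" using compact_attains_sup[OF comp False] by blast
    have "0 < a" "b < 1" "?S \<subseteq> {a..b}" using a b sub by (auto simp: subset_iff)
    then show ?thesis by (rule that)
  qed
  \<comment> \<open>The cap \<open>1/4\<close> gives \<open>4 * \<kappa> \<le> 1\<close>, which
    later keeps the number of summations by parts at most \<open>K\<close>.\<close>
  define \<kappa> where "\<kappa> = min (1/4) (min a (1 - b))"
  have \<kappa>: "0 < \<kappa>" using ab by (simp add: \<kappa>_def)
  have \<kappa>4: "\<kappa> \<le> 1 / 4" unfolding \<kappa>_def by (rule min.cobounded1)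
  have supp: "\<kappa> \<le> x \<and> x \<le> 1 - \<kappa>" if "f x \<noteq> 0" for x
  proof -
    have "x \<in> ?S" using that closure_subset[of "{x. f x \<noteq> 0}"] by auto
    then have "a \<le> x" "x \<le> b" using ab by auto
    then show ?thesis unfolding \<kappa>_def by linarith
  qed
  have "1 \<le> C'" by (simp add: C'_def)
  then show ?thesis using \<kappa> \<kappa>4 supp b by blast
qed

text \<open>Jordan's inequality: the concave sine lies above its chord.\<close>

lemma sin_ge_linear:
  fixes u :: real
  assumes "0 \<le> u" "u \<le> pi / 2"
  shows "2 / pi * u \<le> sin u"
proof -
  have conv: "convex_on {0..pi/2} (\<lambda>x. - sin x)"
  proof (rule convex_on_realI[where f' = "\<lambda>x. - cos x"])
    fix x y :: real assume "x \<in> {0..pi/2}" "y \<in> {0..pi/2}" "x \<le> y"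
    then show "- cos x \<le> - cos y" using cos_monotone_0_pi_le[of x y] by auto
  qed (auto intro!: derivative_eq_intros)
  define t where "t = 2 / pi * u"
  have t: "0 \<le> t" "t \<le> 1" using assms by (auto simp: t_def field_simps)
  have "- sin ((1 - t) *\<^sub>R 0 + t *\<^sub>R (pi/2)) \<le> (1 - t) * (- sin 0) + t * (- sin (pi/2))"
    using convex_onD[OF conv t, of 0 "pi/2"] by auto
  then show ?thesis by (simp add: t_def)
qed

text \<open>The left-out points \<open>\<theta> = 1\<close> and \<open>\<theta> = -1\<close> are
  zeros too, so a linear lower bound needs the margin \<open>\<kappa>\<close>. Up to
  \<open>1 / 2\<close> Jordan's inequality applies directly, beyond it after reflecting
  \<open>|\<theta>|\<close> to \<open>1 - |\<theta>|\<close>.\<close>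

lemma norm_one_minus_cis_ge:
  assumes "\<bar>\<theta>\<bar> \<le> 1 - \<kappa>" "0 < \<kappa>" "\<kappa> \<le> 1 / 4"
  shows "4 * \<kappa> * \<bar>\<theta>\<bar> \<le> cmod (1 - cis (2 * pi * \<theta>))"
proof -
  have "cmod (1 - cis (2 * pi * \<theta>)) = 2 * \<bar>sin (pi * \<theta>)\<bar>"
    using dist_exp_i_1[of "2 * pi * \<theta>"] by (simp add: cis_conv_exp norm_minus_commute)
  also have "\<bar>sin (pi * \<theta>)\<bar> = \<bar>sin (pi * \<bar>\<theta>\<bar>)\<bar>" by (auto simp: abs_if)
  finally have e: "cmod (1 - cis (2 * pi * \<theta>)) = 2 * \<bar>sin (pi * \<bar>\<theta>\<bar>)\<bar>" .
  have "2 * \<kappa> * \<bar>\<theta>\<bar> \<le> sin (pi * \<bar>\<theta>\<bar>)"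
  proof (cases "\<bar>\<theta>\<bar> \<le> 1 / 2")
    case True
    then have "2 / pi * (pi * \<bar>\<theta>\<bar>) \<le> sin (pi * \<bar>\<theta>\<bar>)" by (intro sin_ge_linear) (auto simp: field_simps)
    moreover have "\<kappa> * \<bar>\<theta>\<bar> \<le> 1 * \<bar>\<theta>\<bar>" using assms by (intro mult_right_mono) auto
    ultimately show ?thesis by simp
  next
    case False
    have "2 / pi * (pi * (1 - \<bar>\<theta>\<bar>)) \<le> sin (pi * (1 - \<bar>\<theta>\<bar>))"
      using False assms by (intro sin_ge_linear) (auto simp: field_simps)
    also have "sin (pi * (1 - \<bar>\<theta>\<bar>)) = sin (pi * \<bar>\<theta>\<bar>)" by (simp add: right_diff_distrib)
    finally have "2 * \<kappa> \<le> sin (pi * \<bar>\<theta>\<bar>)" using assms by simp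
    moreover have "\<kappa> * \<bar>\<theta>\<bar> \<le> \<kappa> * 1" using assms by (intro mult_left_mono) auto
    ultimately show ?thesis by linarith
  qed
  then show ?thesis using e by linarith
qed

text \<open>Summing by parts \<open>\<alpha>\<close> times gains a factor \<open>C \<alpha>\<^sup>s / (4 \<kappa> K |\<theta>|)\<close> each time; the optimal
  \<open>\<alpha>\<close> makes this factor about \<open>exp (-1)\<close>.\<close>

lemma gevrey_exp_sum_bound:
  assumes smooth: "smooth_fun f" and s: "1 < s" and C: "1 \<le> C" and \<kappa>: "0 < \<kappa>" "\<kappa> \<le> 1 / 4"
    and supp: "\<And>x. f x \<noteq> 0 \<Longrightarrow> \<kappa> \<le> x \<and> x \<le> 1 - \<kappa>"
    and deriv: "\<And>\<alpha> x. \<bar>(deriv ^^ \<alpha>) f x\<bar> \<le> C ^ (\<alpha> + 1) * fact \<alpha> powr s"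
    and K: "0 < K" and \<theta>: "\<bar>\<theta>\<bar> \<le> 1 - \<kappa>"
  shows "cmod (\<Sum>l<K. complex_of_real (f (real l / real K)) * cis (2 * pi * \<theta>) ^ l)
    \<le> 2 * C * real K * exp (1 - (4 * \<kappa> / (C * exp 1) * (real K * \<bar>\<theta>\<bar>)) powr (1 / s))"
proof -
  define z where "z = cis (2 * pi * \<theta>)"
  define S where "S = cmod (\<Sum>l<K. complex_of_real (f (real l / real K)) * z ^ l)"
  define X where "X = 4 * \<kappa> * (real K * \<bar>\<theta>\<bar>)"
  define t where "t = (X / (C * exp 1)) powr (1 / s)"
  have X0: "0 \<le> X" using \<kappa> by (simp add: X_def)
  have t0: "0 \<le> t" by (simp add: t_def)
  \<comment> \<open>The restriction \<open>\<alpha> \<le> K\<close> keeps the number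
    \<open>K + \<alpha>\<close> of summands at most \<open>2 * K\<close>.\<close>
  have key: "S * X ^ \<alpha> \<le> 2 * C * real K * (C ^ \<alpha> * fact \<alpha> powr s)" if \<alpha>: "\<alpha> \<le> K" for \<alpha>
  proof -
    let ?h = "1 / real K"
    let ?b = "C ^ (\<alpha> + 1) * fact \<alpha> powr s"
    have fz: "f x = 0" if "x \<le> 0 \<or> 1 \<le> x" for x using supp[of x] that \<kappa> by fastforce
    have "S * (cmod (1 - z)) ^ \<alpha>
        = cmod (\<Sum>l<K + \<alpha>. complex_of_real ((bdiff ?h ^^ \<alpha>) f (real l / real K)) * z ^ l)"
      using arg_cong[OF summation_by_parts_iterated[of f K z \<alpha>, OF fz K], of cmod]
      by (simp add: S_def norm_mult norm_power mult.commute)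
    also have "\<dots> \<le> (\<Sum>l<K + \<alpha>. ?h ^ \<alpha> * ?b)"
    proof (rule sum_norm_le)
      fix l
      show "cmod (complex_of_real ((bdiff ?h ^^ \<alpha>) f (real l / real K)) * z ^ l) \<le> ?h ^ \<alpha> * ?b"
        using funpow_bdiff_bound[OF smooth _ deriv, of ?h \<alpha> "real l / real K"]
        by (simp add: norm_mult norm_power z_def)
    qed
    also have "\<dots> = real (K + \<alpha>) * (?h ^ \<alpha> * ?b)" by simp
    also have "\<dots> \<le> (2 * real K) * (?h ^ \<alpha> * ?b)"
      using \<alpha> C by (intro mult_right_mono) auto
    finally have 1: "S * (cmod (1 - z)) ^ \<alpha> \<le> (2 * real K) * (?h ^ \<alpha> * ?b)" .
    have "S * X ^ \<alpha> = S * (4 * \<kappa> * \<bar>\<theta>\<bar>) ^ \<alpha> * real K ^ \<alpha>" by (simp add: X_def power_mult_distrib)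
    also have "\<dots> \<le> S * (cmod (1 - z)) ^ \<alpha> * real K ^ \<alpha>"
      unfolding z_def using norm_one_minus_cis_ge[OF \<theta> \<kappa>] \<kappa>
      by (intro mult_right_mono mult_left_mono power_mono) (auto simp: S_def)
    also have "\<dots> \<le> (2 * real K) * (?h ^ \<alpha> * ?b) * real K ^ \<alpha>"
      by (intro mult_right_mono 1) auto
    also have "\<dots> = 2 * C * real K * (C ^ \<alpha> * fact \<alpha> powr s)"
      using K by (simp add: power_divide)
    finally show ?thesis .
  qed
  \<comment> \<open>Rounding \<open>t\<close> down costs at most a factor \<open>exp 1\<close>, the
    origin of the \<open>1\<close> in the exponent. For \<open>\<alpha> = 0\<close> the trivial
    bound suffices.\<close>
  define \<alpha> where "\<alpha> = nat \<lfloor>t\<rfloor>"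
  have at: "real \<alpha> \<le> t" "t < real \<alpha> + 1" using t0 by (auto simp: \<alpha>_def)
  have "S \<le> 2 * C * real K * exp (1 - t)"
  proof (cases "\<alpha> = 0")
    case True
    have "2 * C * real K * 1 \<le> 2 * C * real K * exp (1 - t)"
      using True at C by (intro mult_left_mono) auto
    then show ?thesis using key[of 0] by simp
  next
    case False
    then have a1: "1 \<le> real \<alpha>" by simp
    have tp: "0 < t" using at a1 by linarith
    then have Xp: "0 < X" using X0 by (cases "X = 0") (auto simp: t_def)
    have ts: "t powr s = X / (C * exp 1)"
      unfolding t_def using Xp C s by (simp add: powr_powr)
    have aK: "\<alpha> \<le> K"
    proof -
      have "X \<le> 1 * (real K * 1)" unfolding X_def using \<kappa> \<theta> by (intro mult_mono) auto
      moreover have "1 * 1 \<le> C * exp (1::real)" using C by (intro mult_mono) auto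
      ultimately have "X / (C * exp 1) \<le> real K / 1" using Xp by (intro frac_le) auto
      then have "t \<le> real K powr (1 / s)" unfolding t_def using Xp C s by (intro powr_mono2) auto
      also have "\<dots> \<le> real K powr 1" using K s by (intro powr_mono) auto
      finally show ?thesis using at(1) K by simp
    qed
    \<comment> \<open>By the choice of \<open>t\<close>, \<open>C * t powr s\<close> equals
      \<open>X / exp 1\<close>, so bounding the factorial by \<open>t ^ \<alpha>\<close> leaves a
      gain of \<open>exp (-1)\<close> per summation by parts.\<close>
    have "fact \<alpha> powr s \<le> (real \<alpha> ^ \<alpha>) powr s"
      using s fact_le_power[of \<alpha>, where 'a = real] by (intro powr_mono2) auto
    also have "\<dots> = (real \<alpha> powr s) ^ \<alpha>"
      using a1 by (simp add: powr_realpow[symmetric] powr_powr mult.commute)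
    also have "\<dots> \<le> (t powr s) ^ \<alpha>" using at(1) s by (intro power_mono powr_mono2) auto
    finally have "C ^ \<alpha> * fact \<alpha> powr s \<le> C ^ \<alpha> * (t powr s) ^ \<alpha>" using C by (intro mult_left_mono) auto
    also have "\<dots> = X ^ \<alpha> * exp (- real \<alpha>)"
      unfolding ts using C by (simp add: power_divide power_mult_distrib exp_minus exp_of_nat_mult[symmetric] field_simps)
    finally have "S * X ^ \<alpha> \<le> 2 * C * real K * (X ^ \<alpha> * exp (- real \<alpha>))"
      using key[OF aK] C by (meson mult_left_mono order_trans mult_nonneg_nonneg of_nat_0_le_iff zero_le_numeral zero_le_one)
    then have "X ^ \<alpha> * S \<le> X ^ \<alpha> * (2 * C * real K * exp (- real \<alpha>))" by (simp add: mult_ac)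
    then have "S \<le> 2 * C * real K * exp (- real \<alpha>)" using Xp by simp
    also have "\<dots> \<le> 2 * C * real K * exp (1 - t)" using at C by (intro mult_left_mono) auto
    finally show ?thesis .
  qed
  then show ?thesis by (simp add: S_def z_def t_def X_def)
qed

section \<open>Matrix entries of the baker's map\<close>

lemma dft_mat_carrier: "dft_mat N \<in> carrier_mat N N"
  and Pi_mat_carrier: "Pi_mat K N a \<in> carrier_mat K N"
  and chi_mat_carrier: "chi_mat f K \<in> carrier_mat K K"
  by (auto simp: dft_mat_def Pi_mat_def chi_mat_def)

lemma index_dft_mat:
  "i < N \<Longrightarrow> j < N \<Longrightarrow>
    dft_mat N $$ (i, j) = cis (- (2 * pi * real i * real j / real N)) / complex_of_real (sqrt (real N))"
  by (simp add: dft_mat_def cis_conv_exp mult_ac)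

lemma index_mult_chi_mat:
  assumes X: "X \<in> carrier_mat m K" and "i < m" "j < K"
  shows "(X * chi_mat f K) $$ (i, j) = X $$ (i, j) * complex_of_real (f (real j / real K))"
proof -
  have "(X * chi_mat f K) $$ (i, j)
      = (\<Sum>k<K. if k = j then X $$ (i, j) * complex_of_real (f (real j / real K)) else 0)"
    unfolding index_mult_mat_sum[OF X chi_mat_carrier assms(2,3)]
    using assms by (intro sum.cong) (auto simp: chi_mat_def)
  then show ?thesis using assms by simp
qed

lemma index_mult_Pi_mat:
  assumes X: "X \<in> carrier_mat m K" and "i < m" "n < N" "0 < K"
  shows "(X * Pi_mat K N a) $$ (i, n) = (if n div K = a then X $$ (i, n mod K) else 0)"
proof -
  have "n = k + a * K \<longleftrightarrow> n div K = a \<and> k = n mod K" if "k < K" for k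
    using that by (auto simp: div_mult_mod_eq add.commute)
  then have "(X * Pi_mat K N a) $$ (i, n)
      = (\<Sum>k<K. if k = n mod K then (if n div K = a then X $$ (i, n mod K) else 0) else 0)"
    unfolding index_mult_mat_sum[OF X Pi_mat_carrier assms(2,3)]
    using assms by (intro sum.cong) (auto simp: Pi_mat_def)
  then show ?thesis using assms by simp
qed

lemma index_mult_Pi_mat_adjoint:
  assumes X: "X \<in> carrier_mat m N" and "i < m" "l < K" "l + a * K < N"
  shows "(X * mat_adjoint (Pi_mat K N a)) $$ (i, l) = X $$ (i, l + a * K)"
proof -
  have "(X * mat_adjoint (Pi_mat K N a)) $$ (i, l)
      = (\<Sum>k<N. if k = l + a * K then X $$ (i, k) else 0)"
    unfolding index_mult_mat_sum[OF X mat_adjoint_carrier[OF Pi_mat_carrier] assms(2,3)]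
    using assms Pi_mat_carrier[of K N a] by (intro sum.cong) (auto simp: Pi_mat_def)
  then show ?thesis using assms by simp
qed

text \<open>The inverse transform on \<open>N\<close> points contributes the phase of
  \<open>(l + a * K) * i / N\<close>, the forward one on \<open>K\<close> points that of
  \<open>- l * j / K\<close>, with \<open>j = n mod K\<close>. Together they leave a unimodular
  prefactor and an exponential sum of frequency \<open>i / N - j / K\<close>.\<close>

lemma index_baker_block:
  assumes a: "a < M" and K: "0 < K" and i: "i < K * M" and n: "n < K * M"
  shows "(mat_adjoint (dft_mat (K * M)) * mat_adjoint (Pi_mat K (K * M) a) * chi_mat f K * dft_mat K
          * chi_mat f K * Pi_mat K (K * M) a) $$ (i, n)
    = (if n div K = a then
        cis (2 * pi * real a * real i / real M) / complex_of_real (sqrt (real (K * M)) * sqrt (real K))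
        * (\<Sum>l<K. complex_of_real (f (real l / real K)) * cis (2 * pi * (real i / real (K * M) - real (n mod K) / real K)) ^ l)
        * complex_of_real (f (real (n mod K) / real K)) else 0)"
proof -
  let ?N = "K * M"
  define j where "j = n mod K"
  have j: "j < K" using K by (simp add: j_def)
  note F = mat_adjoint_carrier[OF dft_mat_carrier[of ?N]]
  let ?X1 = "mat_adjoint (dft_mat ?N) * mat_adjoint (Pi_mat K ?N a)"
  have X1: "?X1 \<in> carrier_mat ?N K" using F mat_adjoint_carrier[OF Pi_mat_carrier] by (rule mult_carrier_mat)
  have X2: "?X1 * chi_mat f K \<in> carrier_mat ?N K" using X1 chi_mat_carrier by (rule mult_carrier_mat)
  have X3: "?X1 * chi_mat f K * dft_mat K \<in> carrier_mat ?N K" using X2 dft_mat_carrier by (rule mult_carrier_mat)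
  have X4: "?X1 * chi_mat f K * dft_mat K * chi_mat f K \<in> carrier_mat ?N K" using X3 chi_mat_carrier by (rule mult_carrier_mat)
  have la: "l + a * K < ?N" if "l < K" for l
  proof -
    have "l + a * K < (a + 1) * K" using that by simp
    also have "\<dots> \<le> M * K" using a by (intro mult_right_mono) auto
    finally show ?thesis by (simp add: mult.commute)
  qed
  define w where "w = cis (2 * pi * (real i / real ?N - real j / real K))"
  define c where "c = cis (2 * pi * real a * real i / real M) / complex_of_real (sqrt (real ?N) * sqrt (real K))"
  have "?X1 $$ (i, l) = cnj (dft_mat ?N $$ (l + a * K, i))" if "l < K" for l
    using index_mult_Pi_mat_adjoint[OF F i that la[OF that]] la[OF that] i dft_mat_carrier[of ?N] by simp
  then have x2: "(?X1 * chi_mat f K) $$ (i, l)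
      = cnj (dft_mat ?N $$ (l + a * K, i)) * complex_of_real (f (real l / real K))" if "l < K" for l
    using index_mult_chi_mat[OF X1 i that] that by simp
  have "(?X1 * chi_mat f K * dft_mat K) $$ (i, j)
      = (\<Sum>l<K. cnj (dft_mat ?N $$ (l + a * K, i)) * complex_of_real (f (real l / real K)) * dft_mat K $$ (l, j))"
    unfolding index_mult_mat_sum[OF X2 dft_mat_carrier i j] using x2 by simp
  also have "\<dots> = (\<Sum>l<K. c * (complex_of_real (f (real l / real K)) * w ^ l))"
  proof (rule sum.cong[OF refl])
    fix l assume "l \<in> {..<K}"
    then have l: "l < K" by simp
    have "2 * pi * real (l + a * K) * real i / real ?N + - (2 * pi * real l * real j / real K)
        = 2 * pi * real a * real i / real M + real l * (2 * pi * (real i / real ?N - real j / real K))"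
      using K a by (simp add: field_simps)
    then have "cis (2 * pi * real (l + a * K) * real i / real ?N) * cis (- (2 * pi * real l * real j / real K))
        = cis (2 * pi * real a * real i / real M) * w ^ l"
      unfolding w_def Complex.DeMoivre cis_mult by (simp only:)
    then show "cnj (dft_mat ?N $$ (l + a * K, i)) * complex_of_real (f (real l / real K)) * dft_mat K $$ (l, j)
        = c * (complex_of_real (f (real l / real K)) * w ^ l)"
      unfolding index_dft_mat[OF la[OF l] i] index_dft_mat[OF l j] c_def
      by (simp add: cis_cnj)
  qed
  also have "\<dots> = c * (\<Sum>l<K. complex_of_real (f (real l / real K)) * w ^ l)" by (simp add: sum_distrib_left)
  finally have "(?X1 * chi_mat f K * dft_mat K * chi_mat f K) $$ (i, j)
      = c * (\<Sum>l<K. complex_of_real (f (real l / real K)) * w ^ l) * complex_of_real (f (real j / real K))"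
    using index_mult_chi_mat[OF X3 i j] by simp
  then show ?thesis
    unfolding index_mult_Pi_mat[OF X4 i n K] by (simp add: j_def c_def w_def)
qed

text \<open>The cutoff applied first confines \<open>j / K\<close> to the support of
  \<open>f\<close>, which keeps the frequency away from 1 in modulus; the other cutoff is the Gevrey
  amplitude of the exponential sum. The constants are chosen before \<open>\<A>\<close> and
  \<open>K\<close>.\<close>

lemma baker_entry_bound:
  assumes g: "gevrey_c01 s f" and s: "1 < s" and f: "\<forall>x. 0 \<le> f x \<and> f x \<le> 1" and M: "2 \<le> M"
  obtains C c :: real where "1 \<le> C" "0 < c"
    "\<And>\<A> K i n. \<A> \<subseteq> {0..<M} \<Longrightarrow> 0 < K \<Longrightarrow> i < K * M \<Longrightarrow> n < K * M \<Longrightarrow>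
      cmod (baker_mat M \<A> f K $$ (i, n))
        \<le> (if n div K \<in> \<A> then C * exp (- ((c * \<bar>real i - real M * real (n mod K)\<bar>) powr (1 / s))) else 0)"
proof -
  obtain C \<kappa> where C: "1 \<le> C" and \<kappa>: "0 < \<kappa>" "\<kappa> \<le> 1 / 4"
    and supp: "\<And>x. f x \<noteq> 0 \<Longrightarrow> \<kappa> \<le> x \<and> x \<le> 1 - \<kappa>"
    and deriv: "\<And>\<alpha> x. \<bar>(deriv ^^ \<alpha>) f x\<bar> \<le> C ^ (\<alpha> + 1) * fact \<alpha> powr s"
    using gevrey_c01_bounds[OF g] by blast
  have smooth: "smooth_fun f" using g by (simp add: gevrey_c01_def)
  \<comment> \<open>The factor \<open>1 / M\<close> comes from
    \<open>K * |\<theta>| = |i - M * j| / M\<close>.\<close>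
  define c where "c = 4 * \<kappa> / (C * exp 1) / real M"
  show ?thesis
  proof (rule that[of "2 * C * exp 1" c])
    have "1 * 1 \<le> 2 * C * exp (1::real)" using C by (intro mult_mono) auto
    then show "1 \<le> 2 * C * exp 1" by simp
    show "0 < c" using \<kappa> C M by (simp add: c_def)
    fix \<A> K i n assume \<A>: "\<A> \<subseteq> {0..<M}" and K: "0 < K" and i: "i < K * M" and n: "n < K * M"
    let ?N = "K * M"
    define j where "j = n mod K"
    define a where "a = n div K"
    define \<theta> where "\<theta> = real i / real ?N - real j / real K"
    define S where "S = (\<Sum>l<K. complex_of_real (f (real l / real K)) * cis (2 * pi * \<theta>) ^ l)"
    define E where "E = exp (- ((c * \<bar>real i - real M * real j\<bar>) powr (1 / s)))"
    have fin: "finite \<A>" using \<A> finite_subset by blast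
    have "baker_mat M \<A> f K $$ (i, n) = (\<Sum>b\<in>\<A>. if a = b then
        cis (2 * pi * real b * real i / real M) / complex_of_real (sqrt (real ?N) * sqrt (real K))
        * S * complex_of_real (f (real j / real K)) else 0)"
      unfolding baker_mat_def Let_def using i n \<A> index_baker_block[OF _ K i n]
      by (auto simp: S_def \<theta>_def j_def a_def intro!: sum.cong)
    also have "\<dots> = (if a \<in> \<A> then
        cis (2 * pi * real a * real i / real M) / complex_of_real (sqrt (real ?N) * sqrt (real K))
        * S * complex_of_real (f (real j / real K)) else 0)" using fin by simp
    finally have e: "cmod (baker_mat M \<A> f K $$ (i, n)) = (if a \<in> \<A> then
        cmod S * f (real j / real K) / (sqrt (real ?N) * sqrt (real K)) else 0)"
      using f by (simp add: norm_mult norm_divide)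
    have "cmod S * f (real j / real K) / (sqrt (real ?N) * sqrt (real K)) \<le> 2 * C * exp 1 * E"
    proof (cases "f (real j / real K) = 0")
      case True
      then show ?thesis using C by (simp add: E_def)
    next
      case False
      have ji: "\<kappa> \<le> real j / real K" "real j / real K \<le> 1 - \<kappa>" using supp[OF False] by auto
      have "real i \<le> real ?N" using i by (simp only: of_nat_le_iff)
      then have "0 \<le> real i / real ?N" "real i / real ?N \<le> 1" using K M by (auto simp: divide_le_eq_1)
      then have \<theta>: "\<bar>\<theta>\<bar> \<le> 1 - \<kappa>" unfolding \<theta>_def using ji by linarith
      have "real K * \<bar>\<theta>\<bar> = \<bar>real K * \<theta>\<bar>" by (simp add: abs_mult)
      also have "real K * \<theta> = (real i - real M * real j) / real M" using K M by (simp add: \<theta>_def field_simps)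
      also have "\<bar>\<dots>\<bar> = \<bar>real i - real M * real j\<bar> / real M" by simp
      finally have K\<theta>: "4 * \<kappa> / (C * exp 1) * (real K * \<bar>\<theta>\<bar>) = c * \<bar>real i - real M * real j\<bar>"
        by (simp add: c_def)
      have "cmod S \<le> 2 * C * real K * exp (1 - (4 * \<kappa> / (C * exp 1) * (real K * \<bar>\<theta>\<bar>)) powr (1 / s))"
        unfolding S_def by (rule gevrey_exp_sum_bound[OF smooth s C \<kappa> supp deriv K \<theta>])
      also have "\<dots> = 2 * C * exp 1 * E * real K"
        unfolding K\<theta> E_def by (simp add: exp_diff exp_minus field_simps)
      finally have S: "cmod S \<le> 2 * C * exp 1 * E * real K" .
      \<comment> \<open>The two Fourier normalisations supply the factor \<open>1 / K\<close> that
        cancels the length of the sum.\<close>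
      have "sqrt (real K) * sqrt (real K) \<le> sqrt (real ?N) * sqrt (real K)"
        using K M by (intro mult_right_mono) auto
      then have sq: "real K \<le> sqrt (real ?N) * sqrt (real K)" by simp
      have "cmod S * f (real j / real K) / (sqrt (real ?N) * sqrt (real K)) \<le> cmod S * 1 / real K"
        using f K sq by (intro frac_le mult_left_mono) auto
      also have "\<dots> \<le> 2 * C * exp 1 * E" using S K by (simp add: divide_le_eq)
      finally show ?thesis .
    qed
    then show "cmod (baker_mat M \<A> f K $$ (i, n))
        \<le> (if n div K \<in> \<A> then 2 * C * exp 1 * exp (- ((c * \<bar>real i - real M * real (n mod K)\<bar>) powr (1 / s))) else 0)"
      unfolding e E_def j_def a_def by auto
  qed
qed

section \<open>Schur test and Cantor neighbourhoods\<close>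

text \<open>Cauchy-Schwarz with the kernel split into square roots. The entry bound carries the
  factor \<open>f k\<close> and so has content only where \<open>f\<close> is nonzero; this gives a
  better constant for vectors vanishing on a set of columns.\<close>

lemma schur_test:
  fixes A :: "nat \<Rightarrow> nat \<Rightarrow> complex" and f :: "nat \<Rightarrow> complex"
  assumes g: "\<And>i k. i < N \<Longrightarrow> k < N \<Longrightarrow> 0 \<le> g i k"
    and A: "\<And>i k. i < N \<Longrightarrow> k < N \<Longrightarrow> cmod (A i k * f k) \<le> g i k * cmod (f k)"
    and row: "\<And>i. i < N \<Longrightarrow> (\<Sum>k<N. g i k) \<le> G"
    and col: "\<And>k. k < N \<Longrightarrow> (\<Sum>i<N. g i k) \<le> G"
    and G: "0 \<le> G"
  shows "(\<Sum>i<N. (cmod (\<Sum>k<N. A i k * f k))\<^sup>2) \<le> G\<^sup>2 * (\<Sum>k<N. (cmod (f k))\<^sup>2)"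
proof -
  have "(\<Sum>i<N. (cmod (\<Sum>k<N. A i k * f k))\<^sup>2) \<le> (\<Sum>i<N. G * (\<Sum>k<N. g i k * (cmod (f k))\<^sup>2))"
  proof (rule sum_mono)
    fix i assume "i \<in> {..<N}"
    then have i: "i < N" by simp
    have "cmod (\<Sum>k<N. A i k * f k) \<le> (\<Sum>k<N. g i k * cmod (f k))"
      using A[OF i] by (intro sum_norm_le) auto
    then have "(cmod (\<Sum>k<N. A i k * f k))\<^sup>2 \<le> (\<Sum>k<N. g i k * cmod (f k))\<^sup>2"
      by (intro power_mono) auto
    also have "(\<Sum>k<N. g i k * cmod (f k)) = (\<Sum>k<N. sqrt (g i k) * (sqrt (g i k) * cmod (f k)))"
      using g[OF i] by (intro sum.cong) (auto simp: mult.assoc[symmetric])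
    also have "\<dots>\<^sup>2 \<le> (\<Sum>k<N. (sqrt (g i k))\<^sup>2) * (\<Sum>k<N. (sqrt (g i k) * cmod (f k))\<^sup>2)"
      by (rule Cauchy_Schwarz_ineq_sum)
    also have "\<dots> = (\<Sum>k<N. g i k) * (\<Sum>k<N. g i k * (cmod (f k))\<^sup>2)"
      using g[OF i] by (simp add: power_mult_distrib)
    also have "\<dots> \<le> G * (\<Sum>k<N. g i k * (cmod (f k))\<^sup>2)"
      using row[OF i] g[OF i] by (intro mult_right_mono sum_nonneg) auto
    finally show "(cmod (\<Sum>k<N. A i k * f k))\<^sup>2 \<le> G * (\<Sum>k<N. g i k * (cmod (f k))\<^sup>2)" .
  qed
  also have "\<dots> = G * (\<Sum>k<N. (\<Sum>i<N. g i k) * (cmod (f k))\<^sup>2)"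
    unfolding sum_distrib_left[symmetric] sum_distrib_right by (subst sum.swap) simp
  also have "\<dots> \<le> G * (\<Sum>k<N. G * (cmod (f k))\<^sup>2)"
    using col G by (intro mult_left_mono sum_mono mult_right_mono) auto
  finally show ?thesis by (simp add: sum_distrib_left power2_eq_square mult.assoc)
qed

text \<open>A single term \<open>x ^ m / fact m\<close> of the exponential series with
  \<open>m \<ge> 2 * s\<close> already forces decay of order \<open>1 / p ^ 2\<close>.\<close>

lemma summable_stretched_exp:
  fixes c s :: real
  assumes c: "0 < c" and s: "1 < s"
  shows "summable (\<lambda>p. exp (- ((c * real p) powr (1 / s)) / 2))"
proof -
  obtain m :: nat where m: "2 * s \<le> real m" using real_arch_simple by blast
  define B where "B = fact m * 2 ^ m / (c ^ 2)"
  show ?thesis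
  proof (rule summable_comparison_test_ev)
    show "summable (\<lambda>p. B * (1 / real p ^ 2))"
      using inverse_power_summable[of 2, where 'a = real] by (intro summable_mult) (simp add: inverse_eq_divide)
    show "\<forall>\<^sub>F p in sequentially. norm (exp (- ((c * real p) powr (1 / s)) / 2)) \<le> B * (1 / real p ^ 2)"
      using eventually_ge_at_top[of "nat \<lceil>1 / c\<rceil>"]
    proof eventually_elim
      case (elim p)
      have "1 / c \<le> real p" using elim by linarith
      then have cp: "1 \<le> c * real p" using c by (simp add: field_simps)
      have p: "0 < real p" using cp c by (cases "p = 0") auto
      define x where "x = (c * real p) powr (1 / s) / 2"
      have x: "0 < x" using c p by (simp add: x_def)
      have "(c * real p) ^ 2 = (c * real p) powr 2" using cp by (subst powr_numeral) auto
      also have "\<dots> \<le> (c * real p) powr (1 / s * real m)"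
        using cp m s by (intro powr_mono) (auto simp: field_simps)
      also have "\<dots> = (2 * x) ^ m"
        using c p by (simp add: x_def powr_power)
      also have "\<dots> \<le> 2 ^ m * (fact m * exp x)"
      proof -
        have "x ^ m / fact m \<le> exp x"
        proof -
          have "x ^ m / fact m = (\<Sum>i\<in>{m}. inverse (fact i) * x ^ i)" by (simp add: field_simps)
          also have "\<dots> \<le> (\<Sum>i. inverse (fact i) * x ^ i)"
            using x summable_exp[of x] by (intro sum_le_suminf) auto
          finally show ?thesis by (simp add: exp_def)
        qed
        then show ?thesis by (simp add: power_mult_distrib field_simps)
      qed
      finally have "(c * real p) ^ 2 * exp (- x) \<le> 2 ^ m * fact m"
        by (simp add: exp_minus field_simps)
      then have "exp (- x) \<le> 2 ^ m * fact m / (c * real p) ^ 2"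
        using c p by (simp add: le_divide_eq mult.commute)
      then show ?case using c p by (simp add: x_def B_def power_mult_distrib field_simps)
    qed
  qed
qed

text \<open>An injective integer family takes each absolute value at most twice, once per
  sign.\<close>

lemma sum_stretched_exp_inj_le:
  fixes c s :: real
  assumes c: "0 < c" and s: "1 < s" and I: "finite I" and g: "inj_on g I"
  shows "(\<Sum>i\<in>I. exp (- ((c * \<bar>real_of_int (g i)\<bar>) powr (1 / s)) / 2))
    \<le> 2 * (\<Sum>p. exp (- ((c * real p) powr (1 / s)) / 2))" (is "_ \<le> 2 * ?W")
proof -
  define \<phi> where "\<phi> p = exp (- ((c * real p) powr (1 / s)) / 2)" for p :: nat
  have half: "(\<Sum>z\<in>Z. \<phi> (nat \<bar>z\<bar>)) \<le> ?W" if "finite Z" "inj_on (\<lambda>z. nat \<bar>z\<bar>) Z" for Z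
  proof -
    have "(\<Sum>z\<in>Z. \<phi> (nat \<bar>z\<bar>)) = (\<Sum>p\<in>(\<lambda>z. nat \<bar>z\<bar>) ` Z. \<phi> p)"
      using that by (simp add: sum.reindex)
    also have "\<dots> \<le> (\<Sum>p. \<phi> p)"
      unfolding \<phi>_def using that summable_stretched_exp[OF c s] by (intro sum_le_suminf) auto
    finally show ?thesis by (simp add: \<phi>_def)
  qed
  define Z where "Z = g ` I"
  have Z: "finite Z" using I by (simp add: Z_def)
  have "(\<Sum>i\<in>I. exp (- ((c * \<bar>real_of_int (g i)\<bar>) powr (1 / s)) / 2)) = (\<Sum>z\<in>Z. \<phi> (nat \<bar>z\<bar>))"
    unfolding Z_def using g by (simp add: sum.reindex \<phi>_def)
  also have "Z = {z \<in> Z. 0 \<le> z} \<union> {z \<in> Z. z < 0}" by auto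
  also have "(\<Sum>z\<in>\<dots>. \<phi> (nat \<bar>z\<bar>)) = (\<Sum>z\<in>{z \<in> Z. 0 \<le> z}. \<phi> (nat \<bar>z\<bar>)) + (\<Sum>z\<in>{z \<in> Z. z < 0}. \<phi> (nat \<bar>z\<bar>))"
    using Z by (intro sum.union_disjoint) auto
  also have "\<dots> \<le> ?W + ?W"
    using Z by (intro add_mono half) (auto simp: inj_on_def)
  finally show ?thesis by simp
qed

text \<open>For \<open>g = 0\<close> these are the successive approximations of the Cantor set of
  base \<open>M\<close> expansions with digits in \<open>\<A>\<close>. The tolerance is imposed
  after the expanding branch, where the distance in the entry bound is measured.\<close>

fun cantor_nbhd :: "(nat \<Rightarrow> real) \<Rightarrow> real \<Rightarrow> nat set \<Rightarrow> nat \<Rightarrow> real set" where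
  "cantor_nbhd g M \<A> 0 = {0..1}"
| "cantor_nbhd g M \<A> (Suc j) = {x. \<exists>a\<in>\<A>. \<exists>y\<in>cantor_nbhd g M \<A> j. \<bar>M * x - real a - y\<bar> \<le> g j}"

text \<open>The gaps \<open>(3/4)\<^bsup>k-j\<^esup> / M\<^sup>j\<close> sum, in units of \<open>M\<^sup>-\<^sup>j\<close>, to a bounded amount, while after
  rescaling by \<open>M\<^sup>k\<close> they still grow geometrically in \<open>k - j\<close>.\<close>

definition gap :: "real \<Rightarrow> nat \<Rightarrow> nat \<Rightarrow> real" where
  "gap M k j = (3 / 4) ^ (k - j) / M ^ j"

text \<open>Each interval at level \<open>j\<close>, widened by the gap on both sides, has
  \<open>card \<A>\<close> preimages contracted by \<open>M\<close>; the geometric gaps keep the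
  normalised length bounded.\<close>

lemma cantor_nbhd_cover:
  assumes M: "0 < M" and \<A>: "finite \<A>" and jk: "j \<le> k"
  shows "\<exists>S. finite S \<and> card S \<le> card \<A> ^ j \<and>
    cantor_nbhd (gap M k) M \<A> j \<subseteq> (\<Union>c\<in>S. {c..c + (1 + 6 * (3 / 4) ^ (k - j)) / M ^ j})"
  using jk
proof (induction j)
  case 0
  have "{0..1} \<subseteq> {0..0 + (1 + 6 * (3 / 4) ^ k :: real)}"
    using zero_le_power[of "3/4 :: real" k] by (auto intro: order_trans)
  then show ?case by (intro exI[of _ "{0}"]) auto
next
  case (Suc j)
  define q :: real where "q = (3 / 4) ^ (k - Suc j)"
  have kj: "k - j = Suc (k - Suc j)" using Suc.prems by simp
  have gq: "gap M k j = (3 / 4) * q / M ^ j" by (simp add: gap_def kj q_def)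
  obtain S where S: "finite S" "card S \<le> card \<A> ^ j"
    and cov: "cantor_nbhd (gap M k) M \<A> j \<subseteq> (\<Union>c\<in>S. {c..c + (1 + 6 * (3 / 4) ^ (k - j)) / M ^ j})"
    using Suc by auto
  let ?h = "\<lambda>(a, c). (real a + c - gap M k j) / M"
  let ?S = "?h ` (\<A> \<times> S)"
  have "card ?S \<le> card (\<A> \<times> S)" using \<A> S by (intro card_image_le) auto
  also have "\<dots> \<le> card \<A> ^ Suc j" using S by (simp add: card_cartesian_product)
  finally have card: "card ?S \<le> card \<A> ^ Suc j" .
  have "x \<in> (\<Union>c\<in>?S. {c..c + (1 + 6 * q) / M ^ Suc j})" if "x \<in> cantor_nbhd (gap M k) M \<A> (Suc j)" for x
  proof -
    obtain a y where a: "a \<in> \<A>" and y: "y \<in> cantor_nbhd (gap M k) M \<A> j"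
      and d: "\<bar>M * x - real a - y\<bar> \<le> gap M k j" using \<open>x \<in> _\<close> by auto
    obtain c where c: "c \<in> S" "c \<le> y" "y \<le> c + (1 + 6 * ((3 / 4) * q)) / M ^ j"
      using cov y unfolding kj power_Suc q_def[symmetric] by (force simp: mult.assoc)
    have lo: "real a + c - gap M k j \<le> M * x" using d c by linarith
    \<comment> \<open>The constant \<open>6\<close> solves
      \<open>6 = (3 / 4) * 6 + 2 * (3 / 4)\<close>, so widening on both sides reproduces the form of
      the length.\<close>
    have "(1 + 6 * q) / M ^ j = (1 + 6 * ((3 / 4) * q)) / M ^ j + 2 * gap M k j"
      unfolding gq by (simp add: add_divide_distrib)
    then have hi: "M * x \<le> real a + c - gap M k j + (1 + 6 * q) / M ^ j" using d c by linarith
    have "?h (a, c) \<le> x" using lo M by (simp add: field_simps)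
    moreover have "x \<le> ?h (a, c) + (1 + 6 * q) / M ^ Suc j"
    proof -
      have "x \<le> (real a + c - gap M k j + (1 + 6 * q) / M ^ j) / M" using hi M by (simp add: le_divide_eq mult.commute)
      also have "\<dots> = ?h (a, c) + (1 + 6 * q) / M ^ Suc j" by (simp add: add_divide_distrib mult.commute)
      finally show ?thesis .
    qed
    ultimately show ?thesis using a c(1) by force
  qed
  then have "cantor_nbhd (gap M k) M \<A> (Suc j) \<subseteq> (\<Union>c\<in>?S. {c..c + (1 + 6 * q) / M ^ Suc j})"
    by (rule subsetI)
  moreover have "finite ?S" using \<A> S by simp
  ultimately show ?case using card unfolding q_def by blast
qed

section \<open>Grid points in Cantor neighbourhoods\<close>

lemma card_nat_in_interval:
  fixes u w :: real
  assumes "0 \<le> w"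
  shows "finite {n::nat. u \<le> real n \<and> real n \<le> u + w}"
    and "real (card {n::nat. u \<le> real n \<and> real n \<le> u + w}) \<le> w + 1"
proof -
  let ?A = "{n::nat. u \<le> real n \<and> real n \<le> u + w}"
  have sub: "int ` ?A \<subseteq> {\<lceil>u\<rceil>..\<lfloor>u + w\<rfloor>}" by (auto simp: ceiling_le_iff le_floor_iff)
  then show fin: "finite ?A" by (metis finite_atLeastAtMost_int finite_imageD finite_subset inj_on_of_nat)
  have "card ?A = card (int ` ?A)" by (simp add: card_image)
  also have "\<dots> \<le> card {\<lceil>u\<rceil>..\<lfloor>u + w\<rfloor>}" by (intro card_mono sub) auto
  also have "\<dots> = nat (\<lfloor>u + w\<rfloor> - \<lceil>u\<rceil> + 1)" by simp
  finally have "real (card ?A) \<le> real (nat (\<lfloor>u + w\<rfloor> - \<lceil>u\<rceil> + 1))" by simp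
  also have "\<dots> \<le> w + 1" using assms by linarith
  finally show "real (card ?A) \<le> w + 1" .
qed

lemma card_grid_cantor_nbhd:
  assumes M: "0 < M" and \<A>: "finite \<A>" and N: "0 < N"
  shows "real (card {n. n < N \<and> real n / real N \<in> cantor_nbhd (gap M k) M \<A> k})
    \<le> real (card \<A>) ^ k * (7 * real N / M ^ k + 1)"
proof -
  \<comment> \<open>At \<open>j = k\<close> the normalised length is
    \<open>1 + 6 = 7\<close>.\<close>
  obtain S where S: "finite S" "card S \<le> card \<A> ^ k"
    and cov: "cantor_nbhd (gap M k) M \<A> k \<subseteq> (\<Union>c\<in>S. {c..c + 7 / M ^ k})"
    using cantor_nbhd_cover[OF M \<A>, of k k] by auto
  define w where "w = 7 * real N / M ^ k"
  have w: "0 \<le> w" using M by (simp add: w_def)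
  let ?I = "\<lambda>c. {n::nat. real N * c \<le> real n \<and> real n \<le> real N * c + w}"
  have "{n. n < N \<and> real n / real N \<in> cantor_nbhd (gap M k) M \<A> k} \<subseteq> (\<Union>c\<in>S. ?I c)"
  proof
    fix n assume "n \<in> {n. n < N \<and> real n / real N \<in> cantor_nbhd (gap M k) M \<A> k}"
    then obtain c where "c \<in> S" "c \<le> real n / real N" "real n / real N \<le> c + 7 / M ^ k"
      using cov by auto
    then have "n \<in> ?I c" using N by (simp add: w_def field_simps)
    then show "n \<in> (\<Union>c\<in>S. ?I c)" using \<open>c \<in> S\<close> by blast
  qed
  then have "card {n. n < N \<and> real n / real N \<in> cantor_nbhd (gap M k) M \<A> k} \<le> card (\<Union>c\<in>S. ?I c)"
    using S card_nat_in_interval(1)[OF w] by (intro card_mono) auto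
  also have "\<dots> \<le> (\<Sum>c\<in>S. card (?I c))" by (rule card_UN_le[OF S(1)])
  finally have "real (card {n. n < N \<and> real n / real N \<in> cantor_nbhd (gap M k) M \<A> k})
      \<le> (\<Sum>c\<in>S. real (card (?I c)))" by (simp flip: of_nat_sum)
  also have "\<dots> \<le> (\<Sum>c\<in>S. w + 1)" by (intro sum_mono card_nat_in_interval(2)[OF w])
  also have "\<dots> = real (card S) * (w + 1)" by simp
  also have "\<dots> \<le> real (card \<A> ^ k) * (w + 1)" using S w by (intro mult_right_mono) (auto simp only: of_nat_le_iff)
  finally show ?thesis by (simp add: w_def)
qed

section \<open>Weights and eigenvalue count\<close>

text \<open>The sets \<open>Y i\<close> need not be nested, so the level is the last index of the
  initial run of memberships, capped at \<open>k\<close>.\<close>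

lemma escape_level_exists:
  assumes "x \<in> Y 0"
  shows "\<exists>j\<le>k. (\<forall>i\<le>j. x \<in> Y i) \<and> (j < k \<longrightarrow> x \<notin> Y (Suc j))"
proof (induction k)
  case 0
  then show ?case using assms by auto
next
  case (Suc k)
  then obtain j where j: "j \<le> k" "\<forall>i\<le>j. x \<in> Y i" "j < k \<longrightarrow> x \<notin> Y (Suc j)" by blast
  show ?case
  proof (cases "j = k \<and> x \<in> Y (Suc k)")
    case True
    then have "\<forall>i\<le>Suc k. x \<in> Y i" using j(2) by (auto simp: le_Suc_eq)
    then show ?thesis by (intro exI[of _ "Suc k"]) auto
  next
    case False
    then show ?thesis using j by (intro exI[of _ j]) auto
  qed
qed

text \<open>Similarity through the diagonal matrix of weights: weights can be introduced without
  affecting the eigenvalue count.\<close>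

lemma char_poly_diagonal_conj:
  fixes B :: "complex mat" and w :: "nat \<Rightarrow> real"
  assumes B: "B \<in> carrier_mat N N" and w: "\<And>i. 0 < w i"
  shows "char_poly (mat N N (\<lambda>(i, j). complex_of_real (w i / w j) * B $$ (i, j))) = char_poly B"
proof -
  let ?A = "mat N N (\<lambda>(i, j). complex_of_real (w i / w j) * B $$ (i, j))"
  let ?D = "\<lambda>u. mat N N (\<lambda>(i, j). if i = j then complex_of_real (u i) else 0)"
  have D: "?D u \<in> carrier_mat N N" for u :: "nat \<Rightarrow> real" by simp
  have left: "(?D u * X) $$ (i, j) = complex_of_real (u i) * X $$ (i, j)"
    if "X \<in> carrier_mat N N" "i < N" "j < N" for u X i j
  proof -
    have "(?D u * X) $$ (i, j) = (\<Sum>k<N. if k = i then complex_of_real (u i) * X $$ (i, j) else 0)"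
      unfolding index_mult_mat_sum[OF D that] using that by (intro sum.cong) auto
    then show ?thesis using that by simp
  qed
  have right: "(X * ?D u) $$ (i, j) = X $$ (i, j) * complex_of_real (u j)"
    if "X \<in> carrier_mat N N" "i < N" "j < N" for u X i j
  proof -
    have "(X * ?D u) $$ (i, j) = (\<Sum>k<N. if k = j then X $$ (i, j) * complex_of_real (u j) else 0)"
      unfolding index_mult_mat_sum[OF that(1) D that(2,3)] using that by (intro sum.cong) auto
    then show ?thesis using that by simp
  qed
  have inv: "?D u * ?D v = 1\<^sub>m N" if "\<And>i. u i * v i = 1" for u v
  proof (rule eq_matI)
    fix i j assume "i < dim_row (1\<^sub>m N :: complex mat)" "j < dim_col (1\<^sub>m N :: complex mat)"
    then have ij: "i < N" "j < N" by auto
    show "(?D u * ?D v) $$ (i, j) = 1\<^sub>m N $$ (i, j)"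
      unfolding left[OF D ij] using ij that by (auto simp flip: of_real_mult)
  qed auto
  have w0: "w i \<noteq> 0" for i using w[of i] by simp
  have "similar_mat_wit ?A B (?D w) (?D (\<lambda>i. 1 / w i))"
  proof (rule similar_mat_witI[of _ _ N])
    show "?D w * ?D (\<lambda>i. 1 / w i) = 1\<^sub>m N" "?D (\<lambda>i. 1 / w i) * ?D w = 1\<^sub>m N"
      using w0 by (intro inv; simp)+
    show "?A = ?D w * B * ?D (\<lambda>i. 1 / w i)"
    proof (rule eq_matI)
      fix i j assume "i < dim_row (?D w * B * ?D (\<lambda>i. 1 / w i))" "j < dim_col (?D w * B * ?D (\<lambda>i. 1 / w i))"
      then have ij: "i < N" "j < N" by auto
      have DB: "?D w * B \<in> carrier_mat N N" by (rule mult_carrier_mat[OF D B])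
      show "?A $$ (i, j) = (?D w * B * ?D (\<lambda>i. 1 / w i)) $$ (i, j)"
        unfolding right[OF DB ij] left[OF B ij] using ij by simp
    qed (use B in auto)
  qed (use B in auto)
  then show ?thesis using char_poly_similar similar_mat_def by blast
qed

text \<open>In a fixed block \<open>n div K = a\<close> the integers
  \<open>i - M * (n mod K)\<close> are distinct; the \<open>M\<close> blocks account for the factor
  \<open>M\<close> in the row sums.\<close>

lemma stretched_exp_row_col_sums:
  fixes c s :: real
  assumes c: "0 < c" and s: "1 < s" and K: "0 < K" and M: "0 < M"
  defines "W \<equiv> \<Sum>p. exp (- ((c * real p) powr (1 / s)) / 2)"
  shows "(\<Sum>n<K * M. exp (- ((c * \<bar>real i - real M * real (n mod K)\<bar>) powr (1 / s)) / 2)) \<le> 2 * real M * W"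
    and "(\<Sum>i<K * M. exp (- ((c * \<bar>real i - real M * real j\<bar>) powr (1 / s)) / 2)) \<le> 2 * W"
proof -
  have cast: "real i - real M * real j = real_of_int (int i - int M * int j)" for i j by simp
  show "(\<Sum>i<K * M. exp (- ((c * \<bar>real i - real M * real j\<bar>) powr (1 / s)) / 2)) \<le> 2 * W"
    unfolding cast W_def by (rule sum_stretched_exp_inj_le[OF c s]) (auto simp: inj_on_def)
  let ?h = "\<lambda>n. exp (- ((c * \<bar>real i - real M * real (n mod K)\<bar>) powr (1 / s)) / 2)"
  have "(\<lambda>n. n div K) ` {..<K * M} \<subseteq> {..<M}"
    using K by (auto simp: less_mult_imp_div_less mult.commute)
  then have "(\<Sum>n<K * M. ?h n) = (\<Sum>a<M. \<Sum>n\<in>{n \<in> {..<K * M}. n div K = a}. ?h n)"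
    by (intro sum.group[symmetric]) auto
  also have "\<dots> \<le> (\<Sum>a<M. 2 * W)"
  proof (rule sum_mono)
    fix a
    show "(\<Sum>n\<in>{n \<in> {..<K * M}. n div K = a}. ?h n) \<le> 2 * W"
      unfolding cast W_def
    proof (rule sum_stretched_exp_inj_le[OF c s])
      show "inj_on (\<lambda>n. int i - int M * int (n mod K)) {n \<in> {..<K * M}. n div K = a}"
      proof (rule inj_onI)
        fix n n' assume n: "n \<in> {n \<in> {..<K * M}. n div K = a}" "n' \<in> {n \<in> {..<K * M}. n div K = a}"
          and e: "int i - int M * int (n mod K) = int i - int M * int (n' mod K)"
        have "n mod K = n' mod K" using e M by simp
        then show "n = n'" using n by (metis (mono_tags, lifting) div_mult_mod_eq mem_Collect_eq)
      qed
    qed simp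
  qed
  finally show "(\<Sum>n<K * M. ?h n) \<le> 2 * real M * W" by simp
qed

text \<open>The weight \<open>T ^ lev n\<close> turns one application of the map, which lowers the escape level, into a
  gain of \<open>1 / T\<close>; transitions that do not lower the level are paid for by the decay of the matrix
  entries at the scale of the gap.\<close>

lemma weighted_eigenvalue_count:
  fixes B :: "complex mat" and c s C T \<eta> :: real
  assumes M: "2 \<le> M" and s: "1 < s" and C: "1 \<le> C" and c: "0 < c" and \<A>: "\<A> \<subseteq> {0..<M}"
    and K: "0 < K" and T: "1 \<le> T" and \<eta>: "0 \<le> \<eta>"
    and B: "B \<in> carrier_mat (K * M) (K * M)"
    and entry: "\<And>i n. i < K * M \<Longrightarrow> n < K * M \<Longrightarrow> cmod (B $$ (i, n))
      \<le> (if n div K \<in> \<A> then C * exp (- ((c * \<bar>real i - real M * real (n mod K)\<bar>) powr (1 / s))) else 0)"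
    and gapT: "\<And>m. 1 \<le> m \<Longrightarrow> m \<le> k \<Longrightarrow>
      T ^ (m + 1) \<le> exp ((c * (real (K * M) / real M ^ k * (3 / 4 * real M) ^ m)) powr (1 / s) / 2)"
  defines "G \<equiv> 2 * real M * C * (\<Sum>p. exp (- ((c * real p) powr (1 / s)) / 2))"
    and "r \<equiv> card {n. n < K * M \<and> real n / real (K * M) \<in> cantor_nbhd (gap (real M) k) (real M) \<A> k}"
    and "e \<equiv> \<Sum>z\<in>{z. poly (char_poly B) z = 0 \<and> \<eta> \<le> cmod z}. Polynomial.order z (char_poly B)"
  shows "1 \<le> G" and "e \<le> K * M" and "r \<le> e \<Longrightarrow> \<eta> ^ e \<le> G ^ r * (G / T) ^ (e - r)"
proof -
  let ?N = "K * M"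
  let ?Y = "cantor_nbhd (gap (real M) k) (real M) \<A>"
  define W where "W = (\<Sum>p. exp (- ((c * real p) powr (1 / s)) / 2))"
  define \<phi> where "\<phi> d = exp (- ((c * d) powr (1 / s)) / 2)" for d :: real
  define R where "R = {n. n < ?N \<and> real n / real ?N \<in> ?Y k}"
  have N: "0 < ?N" using K M by simp
  have W1: "1 \<le> W"
  proof -
    have "(\<Sum>p\<in>{0}. exp (- ((c * real p) powr (1 / s)) / 2)) \<le> W"
      unfolding W_def using summable_stretched_exp[OF c s] by (intro sum_le_suminf) auto
    then show ?thesis by simp
  qed
  have GW: "G = 2 * real M * C * W" by (simp add: G_def W_def)
  have "1 * 1 \<le> 2 * real M * C" using M C by (intro mult_mono) auto
  then have "1 * 1 \<le> (2 * real M * C) * W" using W1 C by (intro mult_mono) auto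
  then show G1: "1 \<le> G" unfolding GW by simp
  have "\<exists>j\<le>k. (\<forall>i\<le>j. real n / real ?N \<in> ?Y i) \<and> (j < k \<longrightarrow> real n / real ?N \<notin> ?Y (Suc j))"
    if "n < ?N" for n
  proof (rule escape_level_exists[where Y = ?Y])
    have "real n \<le> real ?N" using that by (simp only: of_nat_le_iff)
    then show "real n / real ?N \<in> ?Y 0" using N by (simp add: divide_le_eq_1)
  qed
  then obtain lev where lev: "\<And>n. n < ?N \<Longrightarrow> lev n \<le> k"
    "\<And>n i. n < ?N \<Longrightarrow> i \<le> lev n \<Longrightarrow> real n / real ?N \<in> ?Y i"
    "\<And>n. n < ?N \<Longrightarrow> lev n < k \<Longrightarrow> real n / real ?N \<notin> ?Y (Suc (lev n))"
    by metis
  have T0: "0 < T" using T by simp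
  define A where "A = mat ?N ?N (\<lambda>(i, n). complex_of_real (T ^ lev i / T ^ lev n) * B $$ (i, n))"
  have A: "A \<in> carrier_mat ?N ?N" by (simp add: A_def)
  have cpA: "char_poly A = char_poly B"
    unfolding A_def using T0 by (intro char_poly_diagonal_conj[OF B]) auto
  \<comment> \<open>\<open>\<tau> n\<close> is the gain in column \<open>n\<close>: none at level
    \<open>k\<close>, a factor \<open>1 / T\<close> at lower levels.\<close>
  define \<tau> where "\<tau> n = (if lev n = k then 1 else 1 / T)" for n
  have \<tau>1: "\<tau> n \<le> 1" for n using T by (simp add: \<tau>_def)
  have \<tau>0: "0 \<le> \<tau> n" for n using T0 by (simp add: \<tau>_def)
  define d where "d i n = \<bar>real i - real M * real (n mod K)\<bar>" for i n
  have weighted: "cmod (A $$ (i, n)) \<le> C * \<phi> (d i n) * \<tau> n" if i: "i < ?N" and n: "n < ?N" for i n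
  proof (cases "n div K \<in> \<A>")
    case False
    then have "cmod (B $$ (i, n)) \<le> 0" using entry[OF i n] by simp
    then show ?thesis using i n C \<tau>0 by (simp add: A_def \<phi>_def)
  next
    case True
    have cA: "cmod (A $$ (i, n)) = T ^ lev i / T ^ lev n * cmod (B $$ (i, n))"
      using i n T0 by (simp add: A_def norm_mult norm_divide norm_power)
    \<comment> \<open>The decay is split into equal halves: one keeps rows and columns summable, the
      other pays for the weights.\<close>
    have \<phi>2: "exp (- ((c * x) powr (1 / s))) = \<phi> x * \<phi> x" for x
      by (simp add: \<phi>_def exp_add[symmetric])
    have cB: "cmod (B $$ (i, n)) \<le> C * (\<phi> (d i n) * \<phi> (d i n))"
      using entry[OF i n] True by (simp add: d_def \<phi>2)
    have "T ^ lev i / T ^ lev n * \<phi> (d i n) \<le> \<tau> n"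
    proof (cases "lev n = k \<or> lev i < lev n")
      case True
      have "\<phi> (d i n) \<le> 1" by (simp add: \<phi>_def)
      then have "T ^ lev i / T ^ lev n * \<phi> (d i n) \<le> T ^ lev i / T ^ lev n * 1"
        using T0 by (intro mult_left_mono) auto
      also have "T ^ lev i / T ^ lev n * 1 \<le> \<tau> n"
      proof (cases "lev n = k")
        case True
        have "T ^ lev i \<le> T ^ lev n" using True lev(1)[OF i] T by (intro power_increasing) auto
        then show ?thesis using True T0 by (simp add: \<tau>_def)
      next
        case False
        have "T ^ Suc (lev i) \<le> T ^ lev n"
          using False \<open>lev n = k \<or> lev i < lev n\<close> T by (intro power_increasing) auto
        then show ?thesis using False T0 by (simp add: \<tau>_def field_simps)
      qed
      finally show ?thesis .
    next
      case False
      \<comment> \<open>Here the level does not drop: \<open>i\<close> lies in the level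
        \<open>j\<close> set, while \<open>n\<close> is outside the next one, so its image is
        farther than the gap from \<open>i\<close>.\<close>
      define j where "j = lev n"
      define m where "m = k - j"
      have jk: "j < k" and ij: "j \<le> lev i" using False lev(1)[OF n] by (auto simp: j_def)
      have k: "k = j + m" and m1: "1 \<le> m" using jk by (auto simp: m_def)
      have xi: "real i / real ?N \<in> ?Y j" using lev(2)[OF i ij] .
      have xn: "real n / real ?N \<notin> ?Y (Suc j)" using lev(3)[OF n] jk by (simp add: j_def)
      have "real n = real (n div K) * real K + real (n mod K)"
        by (metis div_mult_mod_eq of_nat_add of_nat_mult)
      then have y: "real M * (real n / real ?N) - real (n div K) = real (n mod K) / real K"
        using K M by (simp add: field_simps)
      have "\<not> \<bar>real M * (real n / real ?N) - real (n div K) - real i / real ?N\<bar> \<le> gap (real M) k j"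
        using xn xi \<open>n div K \<in> \<A>\<close> by auto
      then have gt: "gap (real M) k j < \<bar>real (n mod K) / real K - real i / real ?N\<bar>" unfolding y by simp
      have "real ?N * \<bar>real (n mod K) / real K - real i / real ?N\<bar>
          = \<bar>real ?N * (real (n mod K) / real K - real i / real ?N)\<bar>" by (simp add: abs_mult)
      also have "real ?N * (real (n mod K) / real K - real i / real ?N) = real M * real (n mod K) - real i"
        using K M by (simp add: field_simps)
      finally have "real ?N * \<bar>real (n mod K) / real K - real i / real ?N\<bar> = d i n"
        by (simp add: d_def abs_minus_commute)
      then have gd: "real ?N * gap (real M) k j \<le> d i n"
        using mult_left_mono[OF less_imp_le[OF gt], of "real ?N"] by simp
      have ge: "real ?N * gap (real M) k j = real ?N / real M ^ k * (3 / 4 * real M) ^ m"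
        using M by (simp add: gap_def k power_add power_mult_distrib power_divide mult_ac)
      have "T ^ (m + 1) \<le> exp ((c * (real ?N * gap (real M) k j)) powr (1 / s) / 2)"
        unfolding ge using gapT[OF m1] k by simp
      also have "\<dots> \<le> exp ((c * d i n) powr (1 / s) / 2)"
      proof -
        have "(c * (real ?N * gap (real M) k j)) powr (1 / s) \<le> (c * d i n) powr (1 / s)"
          using c s gd by (intro powr_mono2 mult_left_mono) (auto simp: gap_def)
        then show ?thesis by simp
      qed
      finally have Tm: "T ^ (m + 1) * \<phi> (d i n) \<le> 1"
        by (simp add: \<phi>_def exp_minus field_simps)
      \<comment> \<open>The weight ratio is at most \<open>T ^ m\<close>; the exponent
        \<open>m + 1\<close> in \<open>gapT\<close> leaves one more factor \<open>T\<close> for the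
        gain \<open>1 / T\<close>.\<close>
      have "T ^ lev i \<le> T ^ (j + m)" using lev(1)[OF i] k T by (intro power_increasing) auto
      then have "T ^ lev i / T ^ lev n \<le> T ^ m" using T0 by (simp add: j_def power_add field_simps)
      then have "T ^ lev i / T ^ lev n * \<phi> (d i n) \<le> T ^ m * \<phi> (d i n)"
        by (intro mult_right_mono) (auto simp: \<phi>_def)
      also have "\<dots> \<le> 1 / T" using Tm T0 by (simp add: field_simps)
      finally show ?thesis using jk by (simp add: \<tau>_def j_def)
    qed
    then have "C * \<phi> (d i n) * (T ^ lev i / T ^ lev n * \<phi> (d i n)) \<le> C * \<phi> (d i n) * \<tau> n"
      using C by (intro mult_left_mono) (auto simp: \<phi>_def)
    moreover have "cmod (A $$ (i, n)) \<le> T ^ lev i / T ^ lev n * (C * (\<phi> (d i n) * \<phi> (d i n)))"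
      unfolding cA using cB T0 by (intro mult_left_mono) auto
    ultimately show ?thesis by (simp add: mult_ac)
  qed
  have row: "(\<Sum>n<?N. C * \<phi> (d i n)) \<le> G" for i
  proof -
    have "C * (\<Sum>n<?N. \<phi> (d i n)) \<le> C * (2 * real M * W)"
      unfolding \<phi>_def d_def W_def using C M stretched_exp_row_col_sums(1)[OF c s K]
      by (intro mult_left_mono) auto
    then show ?thesis by (simp add: GW sum_distrib_left mult_ac)
  qed
  have col: "(\<Sum>i<?N. C * \<phi> (d i n)) \<le> G" for n
  proof -
    have "C * (\<Sum>i<?N. \<phi> (d i n)) \<le> C * (2 * W)"
      unfolding \<phi>_def d_def W_def using C M stretched_exp_row_col_sums(2)[OF c s K]
      by (intro mult_left_mono) auto
    also have "\<dots> \<le> C * (2 * W) * real M" using C W1 M by simp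
    finally show ?thesis by (simp add: GW sum_distrib_left mult_ac)
  qed
  \<comment> \<open>\<open>t = 1\<close> gives the bound \<open>G\<close> for all vectors,
    \<open>t = 1 / T\<close> the gain on vectors vanishing on \<open>R\<close>.\<close>
  have bounded: "(\<Sum>i<?N. (cmod (\<Sum>n<?N. A $$ (i, n) * f n))\<^sup>2) \<le> (G * t)\<^sup>2 * (\<Sum>n<?N. (cmod (f n))\<^sup>2)"
    if t: "0 \<le> t" and tf: "\<And>n. n < ?N \<Longrightarrow> f n \<noteq> 0 \<Longrightarrow> \<tau> n \<le> t" for f t
  proof (rule schur_test[where g = "\<lambda>i n. C * \<phi> (d i n) * t"])
    fix i n assume i: "i < ?N" and n: "n < ?N"
    show "0 \<le> C * \<phi> (d i n) * t" using C t by (simp add: \<phi>_def)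
    show "cmod (A $$ (i, n) * f n) \<le> C * \<phi> (d i n) * t * cmod (f n)"
    proof (cases "f n = 0")
      case False
      have "C * \<phi> (d i n) * \<tau> n \<le> C * \<phi> (d i n) * t"
        using C tf[OF n False] by (intro mult_left_mono) (auto simp: \<phi>_def)
      then show ?thesis unfolding norm_mult using weighted[OF i n] by (intro mult_right_mono) auto
    qed simp
  next
    fix i show "(\<Sum>n<?N. C * \<phi> (d i n) * t) \<le> G * t"
      unfolding sum_distrib_right[symmetric] using row t by (intro mult_right_mono) auto
  next
    fix n show "(\<Sum>i<?N. C * \<phi> (d i n) * t) \<le> G * t"
      unfolding sum_distrib_right[symmetric] using col t by (intro mult_right_mono) auto
  qed (use G1 t in simp)
  have RN: "R \<subseteq> {..<?N}" by (auto simp: R_def)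
  have \<epsilon>: "0 < G / T" "G / T \<le> G" using G1 T by (auto simp: field_simps)
  have big: "(\<Sum>i<?N. (cmod (\<Sum>n<?N. A $$ (i, n) * f n))\<^sup>2) \<le> G\<^sup>2 * (\<Sum>n<?N. (cmod (f n))\<^sup>2)" for f
    using bounded[of 1 f] \<tau>1 by simp
  have small: "(\<Sum>i<?N. (cmod (\<Sum>n<?N. A $$ (i, n) * f n))\<^sup>2) \<le> (G / T)\<^sup>2 * (\<Sum>n<?N. (cmod (f n))\<^sup>2)"
    if f: "\<forall>n\<in>R. f n = 0" for f
  proof -
    have "\<tau> n \<le> 1 / T" if n: "n < ?N" and fn: "f n \<noteq> 0" for n
    proof -
      have "n \<notin> R" using f fn by auto
      then have "lev n \<noteq> k" using lev(2)[OF n, of k] n by (auto simp: R_def)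
      then show ?thesis by (simp add: \<tau>_def)
    qed
    then show ?thesis using bounded[of "1 / T" f] T0 by simp
  qed
  have rR: "r = card R" by (simp add: r_def R_def)
  show "e \<le> ?N" unfolding e_def cpA[symmetric]
    by (rule eigenvalue_count_bound(1)[OF A RN \<epsilon> \<eta> big small])
  show "\<eta> ^ e \<le> G ^ r * (G / T) ^ (e - r)" if "r \<le> e"
    using eigenvalue_count_bound(2)[OF A RN \<epsilon> \<eta> big small] that unfolding e_def cpA[symmetric] rR by blast
qed

text \<open>By Bernoulli's inequality; it lets the geometric growth of the gap outweigh weight
  exponents linear in the number of levels.\<close>

lemma linear_le_geometric:
  fixes b :: real
  assumes "1 < b"
  shows "min 1 (b - 1) * (real m + 1) \<le> b ^ m"
proof -
  have "min 1 (b - 1) * (real m + 1) = min 1 (b - 1) * real m + min 1 (b - 1)" by (simp add: algebra_simps)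
  also have "\<dots> \<le> (b - 1) * real m + 1" by (intro add_mono mult_right_mono) auto
  also have "\<dots> \<le> (1 + (b - 1)) ^ m" using Bernoulli_inequality[of "b - 1" m] assms by (simp add: algebra_simps)
  finally show ?thesis by simp
qed

section \<open>Choice of constants and the final count\<close>

theorem theorem2:
  fixes M :: nat and ch :: "real \<Rightarrow> real" and s :: real
  assumes "M \<ge> 2" and "s > 1" and "gevrey_c01 s ch"
    and "\<forall>x. 0 \<le> ch x \<and> ch x \<le> 1"
  shows "\<exists>C::real. \<forall>\<A>::nat set. \<A> \<noteq> {} \<longrightarrow> \<A> \<subseteq> {0..<M} \<longrightarrow>
           (let \<delta> = ln (real (card \<A>)) / ln (real M) in
            \<exists>K0::nat. \<forall>K \<ge> K0. \<forall>\<nu>::real. \<nu> \<ge> 1 \<longrightarrow>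
              real (eig_count M \<A> ch K \<nu>)
                \<le> C * real (K * M) powr \<delta> * \<nu> powr ((1 - \<delta>) * s))"
proof -
  note M = assms(1) and s = assms(2)
  obtain C c where C: "1 \<le> C" and c: "0 < c" and entry:
    "\<And>\<A> K i n. \<A> \<subseteq> {0..<M} \<Longrightarrow> 0 < K \<Longrightarrow> i < K * M \<Longrightarrow> n < K * M \<Longrightarrow>
      cmod (baker_mat M \<A> ch K $$ (i, n))
        \<le> (if n div K \<in> \<A> then C * exp (- ((c * \<bar>real i - real M * real (n mod K)\<bar>) powr (1 / s))) else 0)"
    using baker_entry_bound[OF assms(3,2,4,1)] by metis
  define G where "G = 2 * real M * C * (\<Sum>p. exp (- ((c * real p) powr (1 / s)) / 2))"
  have M1: "1 < real M" using M by simp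
  have lnM: "0 < ln (real M)" using M1 by simp
  \<comment> \<open>\<open>p\<close> turns the Schur bound \<open>G\<close> into a power of
    \<open>M\<close>; \<open>P = p + 3\<close> then leaves
    \<open>G / T \<le> M powr (-3 * \<nu>)\<close>, small enough to beat eigenvalues of size
    \<open>M powr (-\<nu>)\<close>.\<close>
  obtain p where p: "G < real M ^ p" using real_arch_pow[OF M1] by blast
  define P where "P = real p + 3"
  \<comment> \<open>\<open>M \<ge> 2\<close> makes \<open>3 / 4 * M\<close> at least
    \<open>3 / 2\<close>, so the gap exponents grow at least like \<open>b ^ m\<close>.\<close>
  define b where "b = (3 / 2) powr (1 / s)"
  have b: "1 < b" unfolding b_def using s by (intro gr_one_powr) auto
  define \<beta> where "\<beta> = min 1 (b - 1)"
  have \<beta>: "0 < \<beta>" using b by (simp add: \<beta>_def)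
  \<comment> \<open>\<open>L\<close> is large enough for the decay across the gaps to dominate the
    weights at every level difference.\<close>
  define L where "L = max 1 ((2 * P * ln (real M) / \<beta>) powr s / c)"
  have L1: "1 \<le> L" by (simp add: L_def)
  have P0: "0 < P" by (simp add: P_def)
  have L: "2 * P * ln (real M) \<le> (c * L) powr (1 / s) * \<beta>"
  proof -
    have "(2 * P * ln (real M) / \<beta>) powr s \<le> c * L"
      using c by (simp add: L_def field_simps max_def)
    then have "((2 * P * ln (real M) / \<beta>) powr s) powr (1 / s) \<le> (c * L) powr (1 / s)"
      using s by (intro powr_mono2) auto
    then have "2 * P * ln (real M) / \<beta> \<le> (c * L) powr (1 / s)"
      using s P0 lnM \<beta> by (simp add: powr_powr)
    then show ?thesis using \<beta> by (simp add: field_simps)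
  qed
  \<comment> \<open>\<open>8 * L * M * \<nu> powr s\<close> will bound the grid points per Cantor
    interval, and \<open>P\<close> the number of eigenvalues per grid point. All constants are fixed
    before \<open>\<A>\<close>.\<close>
  define C0 where "C0 = 8 * P * L * real M"
  have "1 * 1 \<le> 8 * P * real M" using M P0 by (intro mult_mono) (auto simp: P_def)
  then have C0L: "L \<le> C0" unfolding C0_def using L1 mult_left_mono[of 1 "8 * P * real M" L] by (simp add: mult_ac)
  show ?thesis
  \<comment> \<open>\<open>K0 = 1\<close> works because small \<open>N\<close> is covered by the
    trivial count.\<close>
  proof (intro exI[of _ C0] allI impI, unfold Let_def, intro exI[of _ 1] allI impI)
    fix \<A> :: "nat set" and K :: nat and \<nu> :: real
    assume ne: "\<A> \<noteq> {}" and \<A>: "\<A> \<subseteq> {0..<M}" and "1 \<le> K" and \<nu>: "1 \<le> \<nu>"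
    then have K: "0 < K" by simp
    define \<delta> where "\<delta> = ln (real (card \<A>)) / ln (real M)"
    let ?N = "K * M"
    define n where "n = eig_count M \<A> ch K \<nu>"
    have fin: "finite \<A>" using \<A> finite_subset by blast
    have cA: "1 \<le> card \<A>" using ne fin by (simp add: card_gt_0_iff Suc_le_eq)
    have cM: "card \<A> \<le> M" using card_mono[OF _ \<A>] by simp
    have \<delta>: "0 \<le> \<delta>" "\<delta> \<le> 1" using cA cM lnM by (auto simp: \<delta>_def)
    have M\<delta>: "real M powr \<delta> = real (card \<A>)" using cA lnM M by (simp add: powr_def \<delta>_def)
    have N0: "0 < real ?N" using K M by simp
    have \<nu>s: "1 \<le> \<nu> powr s" using \<nu> s by (intro ge_one_powr_ge_zero) auto
    define T where "T = real M powr (P * \<nu>)"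
    have T: "1 \<le> T" unfolding T_def using M P0 \<nu> by (intro ge_one_powr_ge_zero) auto
    define \<eta> where "\<eta> = real M powr (- \<nu>)"
    have B: "baker_mat M \<A> ch K \<in> carrier_mat ?N ?N" by (simp add: baker_mat_def Let_def)
    have nE: "n = (\<Sum>z\<in>{z. poly (char_poly (baker_mat M \<A> ch K)) z = 0 \<and> \<eta> \<le> cmod z}.
        Polynomial.order z (char_poly (baker_mat M \<A> ch K)))"
      by (simp add: n_def eig_count_def Let_def \<eta>_def)
    note count = weighted_eigenvalue_count[OF M s C c \<A> K T _ B entry[OF \<A> K], folded G_def, of \<eta>]
    have "real n \<le> C0 * real ?N powr \<delta> * \<nu> powr ((1 - \<delta>) * s)"
    proof (cases "real ?N < L * \<nu> powr s")
      case True
      \<comment> \<open>With \<open>k = 0\<close> the gap condition is vacuous; only the bound by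
        the dimension is taken.\<close>
      have "n \<le> ?N" unfolding nE by (rule count(2)[of 0]) (auto simp: \<eta>_def)
      then have "real n \<le> real ?N" by (simp only: of_nat_le_iff)
      also have "\<dots> = real ?N powr \<delta> * real ?N powr (1 - \<delta>)"
        using N0 by (simp flip: powr_add)
      also have "\<dots> \<le> real ?N powr \<delta> * (L * \<nu> powr s) powr (1 - \<delta>)"
        using True \<delta> by (intro mult_left_mono powr_mono2) auto
      also have "\<dots> \<le> real ?N powr \<delta> * (C0 * \<nu> powr ((1 - \<delta>) * s))"
      proof (rule mult_left_mono)
        have "L powr (1 - \<delta>) \<le> L powr 1" using L1 \<delta> by (intro powr_mono) auto
        then have "L powr (1 - \<delta>) \<le> C0" using L1 C0L by simp
        moreover have "(L * \<nu> powr s) powr (1 - \<delta>) = L powr (1 - \<delta>) * \<nu> powr ((1 - \<delta>) * s)"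
          using L1 \<nu> by (simp add: powr_mult powr_powr mult.commute)
        ultimately show "(L * \<nu> powr s) powr (1 - \<delta>) \<le> C0 * \<nu> powr ((1 - \<delta>) * s)"
          by (simp add: mult_right_mono)
      qed simp
      finally show ?thesis by (simp add: mult_ac)
    next
      case False
      define X where "X = real ?N / (L * \<nu> powr s)"
      have Lp: "0 < L * \<nu> powr s" using L1 \<nu> by simp
      have X1: "1 \<le> X" using False Lp by (simp add: X_def)
      \<comment> \<open>\<open>k\<close> is the largest exponent with \<open>M ^ k \<le> X\<close>,
        so \<open>N / M ^ k\<close> lies within a factor \<open>M\<close> of
        \<open>L * \<nu> powr s\<close>.\<close>
      obtain k where k: "real M ^ k \<le> X" "X < real M ^ Suc k"
      proof -
        have ex: "\<exists>j. X < real M ^ j" using real_arch_pow[OF M1] by blast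
        define j where "j = (LEAST j. X < real M ^ j)"
        have j: "X < real M ^ j" unfolding j_def using LeastI_ex[OF ex] .
        have "j \<noteq> 0" using j X1 by (intro notI) simp
        then have "\<not> X < real M ^ (j - 1)" unfolding j_def by (intro not_less_Least) (simp add: j_def[symmetric])
        then show ?thesis using that[of "j - 1"] j \<open>j \<noteq> 0\<close> by simp
      qed
      define r where "r = card {n. n < ?N \<and> real n / real ?N \<in> cantor_nbhd (gap (real M) k) (real M) \<A> k}"
      have Mk: "0 < real M ^ k" using M by simp
      have NM: "L * \<nu> powr s \<le> real ?N / real M ^ k" "real ?N / real M ^ k \<le> L * \<nu> powr s * real M"
        using k Lp Mk by (auto simp: X_def field_simps)
      have gapT: "T ^ (m + 1) \<le> exp ((c * (real ?N / real M ^ k * (3 / 4 * real M) ^ m)) powr (1 / s) / 2)" for m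
      proof -
        have "(3 / 2) ^ m \<le> (3 / 4 * real M) ^ m" using M by (intro power_mono) auto
        then have "c * (L * \<nu> powr s * (3 / 2) ^ m) \<le> c * (real ?N / real M ^ k * (3 / 4 * real M) ^ m)"
          using c NM Lp by (intro mult_left_mono mult_mono) auto
        then have "(c * (L * \<nu> powr s * (3 / 2) ^ m)) powr (1 / s)
            \<le> (c * (real ?N / real M ^ k * (3 / 4 * real M) ^ m)) powr (1 / s)"
          using c Lp s by (intro powr_mono2) auto
        moreover have "(c * (L * \<nu> powr s * (3 / 2) ^ m)) powr (1 / s) = (c * L) powr (1 / s) * \<nu> * b ^ m"
        proof -
          have "(c * (L * \<nu> powr s * (3 / 2) ^ m)) powr (1 / s)
              = (c * L) powr (1 / s) * (\<nu> powr s) powr (1 / s) * ((3 / 2) ^ m) powr (1 / s)"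
            using c L1 by (simp add: powr_mult mult.assoc)
          also have "(\<nu> powr s) powr (1 / s) = \<nu>" using \<nu> s by (simp add: powr_powr)
          also have "((3 / 2 :: real) ^ m) powr (1 / s) = b ^ m"
            by (simp add: b_def powr_realpow[symmetric] powr_powr mult.commute)
          finally show ?thesis .
        qed
        moreover have "2 * (P * \<nu> * ln (real M) * (real m + 1)) \<le> (c * L) powr (1 / s) * \<nu> * b ^ m"
        proof -
          have "2 * (P * \<nu> * ln (real M) * (real m + 1)) = 2 * P * ln (real M) * (\<nu> * (real m + 1))" by simp
          also have "\<dots> \<le> (c * L) powr (1 / s) * \<beta> * (\<nu> * (real m + 1))"
            using L \<nu> by (intro mult_right_mono) auto
          also have "\<dots> = (c * L) powr (1 / s) * \<nu> * (\<beta> * (real m + 1))" by simp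
          also have "\<dots> \<le> (c * L) powr (1 / s) * \<nu> * b ^ m"
            using linear_le_geometric[OF b, of m] \<nu> by (intro mult_left_mono) (auto simp: \<beta>_def)
          finally show ?thesis .
        qed
        ultimately have "P * \<nu> * ln (real M) * (real m + 1)
            \<le> (c * (real ?N / real M ^ k * (3 / 4 * real M) ^ m)) powr (1 / s) / 2" by linarith
        moreover have "T ^ (m + 1) = exp (P * \<nu> * ln (real M) * (real m + 1))"
          unfolding T_def using M by (simp add: powr_def exp_of_nat_mult[symmetric] algebra_simps exp_add)
        ultimately show ?thesis by simp
      qed
      have G1: "1 \<le> G" by (rule count(1)[of 0]) (auto simp: \<eta>_def)
      have nr: "real n \<le> P * real r"
      proof (cases "r \<le> n")
        case False
        then have "real n \<le> 1 * real r" by simp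
        also have "\<dots> \<le> P * real r" by (intro mult_right_mono) (auto simp: P_def)
        finally show ?thesis .
      next
        case True
        have Gp: "G \<le> real M powr (real p * \<nu>)"
        proof -
          have "G \<le> real M powr real p" using p M by (simp add: powr_realpow)
          also have "\<dots> \<le> real M powr (real p * \<nu>)" using M \<nu> mult_left_mono[OF \<nu>, of "real p"] by (intro powr_mono) auto
          finally show ?thesis .
        qed
        then have GT: "G / T \<le> real M powr (- 3 * \<nu>)"
        proof -
          have "G / T \<le> real M powr (real p * \<nu>) / T" using Gp T by (intro divide_right_mono) auto
          also have "\<dots> = real M powr (- 3 * \<nu>)"
            unfolding T_def by (simp add: powr_diff[symmetric] P_def algebra_simps)
          finally show ?thesis .
        qed
        have "\<eta> ^ n \<le> G ^ r * (G / T) ^ (n - r)"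
          unfolding nE r_def
          by (rule count(3)) (use gapT True in \<open>auto simp: \<eta>_def r_def nE\<close>)
        also have "\<dots> \<le> (real M powr (real p * \<nu>)) ^ r * (real M powr (- 3 * \<nu>)) ^ (n - r)"
          using Gp GT G1 T by (intro mult_mono power_mono) auto
        also have "\<dots> = real M powr (real p * \<nu> * real r + - 3 * \<nu> * (real n - real r))"
          using M True by (simp add: powr_power of_nat_diff powr_add[symmetric] mult_ac)
        finally have "real M powr (- \<nu> * real n) \<le> real M powr (real p * \<nu> * real r + - 3 * \<nu> * (real n - real r))"
          using M by (simp add: \<eta>_def powr_power mult_ac)
        then have "- \<nu> * real n \<le> real p * \<nu> * real r + - 3 * \<nu> * (real n - real r)"
          using M1 by (simp only: powr_le_cancel_iff)
        \<comment> \<open>Collecting the terms in \<open>r\<close> gives the coefficient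
          \<open>p + 3\<close>, which is \<open>P\<close>.\<close>
        then have "\<nu> * (2 * real n) \<le> \<nu> * (P * real r)" by (simp add: P_def algebra_simps)
        then have "2 * real n \<le> P * real r" using \<nu> by simp
        then show ?thesis by simp
      qed
      have "real r \<le> real (card \<A>) ^ k * (7 * real ?N / real M ^ k + 1)"
        unfolding r_def using card_grid_cantor_nbhd[of "real M" \<A> ?N k] M fin K by simp
      also have "\<dots> \<le> real (card \<A>) ^ k * (8 * L * real M * \<nu> powr s)"
      proof (rule mult_left_mono)
        have "1 * 1 \<le> (L * \<nu> powr s) * real M" using L1 \<nu>s M
          by (intro mult_mono) (auto intro: order_trans[OF _ mult_mono[of 1 L 1 "\<nu> powr s"]])
        then have "7 * (real ?N / real M ^ k) + 1 \<le> 8 * (L * \<nu> powr s * real M)"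
          using NM(2) by linarith
        then show "7 * real ?N / real M ^ k + 1 \<le> 8 * L * real M * \<nu> powr s"
          by (simp add: mult_ac)
      qed simp
      finally have r8: "real r \<le> real (card \<A>) ^ k * (8 * L * real M * \<nu> powr s)" .
      have "real (card \<A>) ^ k \<le> real ?N powr \<delta> * \<nu> powr (- s * \<delta>)"
      proof -
        \<comment> \<open>\<open>M powr \<delta> = card \<A>\<close> turns the number of Cantor
          intervals into a power of \<open>M ^ k\<close>, which the choice of \<open>k\<close>
          bounds by \<open>N / \<nu> powr s\<close>.\<close>
        have "real (card \<A>) ^ k = (real M ^ k) powr \<delta>"
          unfolding M\<delta>[symmetric] using M by (simp add: powr_power powr_realpow[symmetric] powr_powr mult.commute)
        also have "\<dots> \<le> (real ?N / \<nu> powr s) powr \<delta>"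
        proof (rule powr_mono2[OF \<delta>(1)])
          have "X \<le> real ?N / (1 * \<nu> powr s)"
            unfolding X_def using L1 \<nu> by (intro divide_left_mono mult_right_mono) auto
          then show "real M ^ k \<le> real ?N / \<nu> powr s" using k(1) by simp
        qed simp
        also have "\<dots> = real ?N powr \<delta> * \<nu> powr (- s * \<delta>)"
          using N0 \<nu> by (simp add: powr_divide powr_powr powr_minus_divide)
        finally show ?thesis .
      qed
      then have "real (card \<A>) ^ k * (8 * L * real M * \<nu> powr s)
          \<le> real ?N powr \<delta> * \<nu> powr (- s * \<delta>) * (8 * L * real M * \<nu> powr s)"
        using L1 by (intro mult_right_mono) auto
      then have r: "real r \<le> real ?N powr \<delta> * \<nu> powr (- s * \<delta>) * (8 * L * real M * \<nu> powr s)"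
        using r8 by linarith
      \<comment> \<open>The points per interval contribute \<open>\<nu> powr s\<close>, the number
        of intervals \<open>\<nu> powr (- s * \<delta>)\<close>; this is the origin of the exponent
        \<open>(1 - \<delta>) * s\<close>.\<close>
      have "\<nu> powr (- s * \<delta>) * \<nu> powr s = \<nu> powr ((1 - \<delta>) * s)"
        by (simp add: powr_add[symmetric] algebra_simps)
      then have "real ?N powr \<delta> * \<nu> powr (- s * \<delta>) * (8 * L * real M * \<nu> powr s)
          = 8 * L * real M * real ?N powr \<delta> * \<nu> powr ((1 - \<delta>) * s)"
        by (metis mult.assoc mult.commute)
      with r have "real r \<le> 8 * L * real M * real ?N powr \<delta> * \<nu> powr ((1 - \<delta>) * s)" by (simp only:)
      then have "P * real r \<le> P * (8 * L * real M * real ?N powr \<delta> * \<nu> powr ((1 - \<delta>) * s))"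
        using P0 by (intro mult_left_mono) auto
      then show ?thesis using nr by (simp add: C0_def mult_ac)
    qed
    then show "real (eig_count M \<A> ch K \<nu>)
        \<le> C0 * real (K * M) powr (ln (real (card \<A>)) / ln (real M)) *
          \<nu> powr ((1 - ln (real (card \<A>)) / ln (real M)) * s)"
      by (simp only: n_def \<delta>_def)
  qed
qed

end
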